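(* Let $n\ge 1$, let $J_n\in\mathbb{C}^{n\times n}$ satisfy $J_n=-J_n^{-1}=-J_n^*$, and let $Q\in L^1_{\mathrm{loc}}(\mathbb{R},\mathbb{C}^{n\times n})$ be arbitrary (not necessarily selfadjoint-valued). Then the minimal and maximal operators generated in $L^2(\mathbb{R},\mathbb{C}^n)$ by the Dirac type expression $D(Q)y=J_n\frac{dy}{dx}+Q(x)y$ on $\mathbb{R}$ coincide: $$D_{\min}(Q)=D_{\max}(Q).$$
   Context: The maximal operator $D_{\max}(Q)$ in $L^2(\mathbb{R},\mathbb{C}^n)$ has domain $\{y\in L^2(\mathbb{R},\mathbb{C}^n): y\in AC_{\mathrm{loc}}(\mathbb{R},\mathbb{C}^n),\ D(Q)y\in L^2(\mathbb{R},\mathbb{C}^n)\}$ and acts as $D_{\max}(Q)y=D(Q)y$. Here $AC_{\mathrm{loc}}$ denotes functions absolutely continuous on each compact interval. The minimal operator $D_{\min}(Q)$ is the closure of the restriction of $D_{\max}(Q)$ to the functions $y\in\mathrm{dom}\,D_{\max}(Q)$ with compact support. *)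

theory Defs
  imports "HOL-Analysis.Analysis"
begin

section \<open>The Hilbert space of square-integrable functions on the real line\<close>

definition sq_integrable :: "(real \<Rightarrow> 'a::euclidean_space) set" where
  "sq_integrable =
     {f \<in> borel_measurable lebesgue. integrable lebesgue (\<lambda>x. (norm (f x))\<^sup>2)}"

definition l2_rel :: "(real \<Rightarrow> 'a::euclidean_space) \<Rightarrow> (real \<Rightarrow> 'a) \<Rightarrow> bool" where
  "l2_rel f g \<longleftrightarrow>
     f \<in> sq_integrable \<and> g \<in> sq_integrable \<and> (AE x in lebesgue. f x = g x)"

lemma integrable_inner_sq_integrable:
  assumes "f \<in> sq_integrable" "g \<in> sq_integrable"
  shows "integrable lebesgue (\<lambda>x. f x \<bullet> g x)"
proof (rule Bochner_Integration.integrable_bound)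
  show "integrable lebesgue (\<lambda>x. (norm (f x))\<^sup>2 + (norm (g x))\<^sup>2)"
    using assms by (auto simp: sq_integrable_def)
  show "(\<lambda>x. f x \<bullet> g x) \<in> borel_measurable lebesgue"
    using assms by (auto simp: sq_integrable_def intro!: borel_measurable_inner)
  have "\<bar>f x \<bullet> g x\<bar> \<le> (norm (f x))\<^sup>2 + (norm (g x))\<^sup>2" for x
  proof -
    have "\<bar>f x \<bullet> g x\<bar> \<le> norm (f x) * norm (g x)"
      by (rule Cauchy_Schwarz_ineq2)
    moreover have "2 * (norm (f x) * norm (g x)) \<le> (norm (f x))\<^sup>2 + (norm (g x))\<^sup>2"
      using sum_squares_bound[of "norm (f x)" "norm (g x)"] by (simp add: mult.assoc)
    moreover have "0 \<le> norm (f x) * norm (g x)" by simp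
    ultimately show ?thesis by linarith
  qed
  then show "AE x in lebesgue. norm (f x \<bullet> g x) \<le> norm ((norm (f x))\<^sup>2 + (norm (g x))\<^sup>2)"
    by auto
qed

lemma sq_integrable_zero: "(\<lambda>x. 0) \<in> sq_integrable"
  by (simp add: sq_integrable_def)

lemma sq_integrable_scaleR:
  assumes "f \<in> sq_integrable"
  shows "(\<lambda>x. c *\<^sub>R f x) \<in> sq_integrable"
  using assms by (auto simp: sq_integrable_def power_mult_distrib)

lemma sq_integrable_add:
  assumes "f \<in> sq_integrable" "g \<in> sq_integrable"
  shows "(\<lambda>x. f x + g x) \<in> sq_integrable"
proof -
  have "integrable lebesgue (\<lambda>x. (norm (f x))\<^sup>2 + 2 * (f x \<bullet> g x) + (norm (g x))\<^sup>2)"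
    using assms integrable_inner_sq_integrable[OF assms] by (auto simp: sq_integrable_def)
  moreover have "(norm (f x + g x))\<^sup>2 = (norm (f x))\<^sup>2 + 2 * (f x \<bullet> g x) + (norm (g x))\<^sup>2" for x
    by (simp add: power2_norm_eq_inner algebra_simps inner_commute)
  ultimately show ?thesis
    using assms by (auto simp: sq_integrable_def)
qed

lemma sq_integrable_uminus:
  assumes "f \<in> sq_integrable"
  shows "(\<lambda>x. - f x) \<in> sq_integrable"
  using sq_integrable_scaleR[OF assms, of "-1"] by simp

lemma sq_integrable_diff:
  assumes "f \<in> sq_integrable" "g \<in> sq_integrable"
  shows "(\<lambda>x. f x - g x) \<in> sq_integrable"
  using sq_integrable_add[OF assms(1) sq_integrable_uminus[OF assms(2)]] by simp

lemma part_equivp_l2_rel: "part_equivp l2_rel"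
proof (rule part_equivpI)
  show "\<exists>f. l2_rel f f"
    by (rule exI[of _ "\<lambda>x. 0"]) (simp add: l2_rel_def sq_integrable_zero)
  show "symp l2_rel"
    by (auto simp: symp_def l2_rel_def elim: eventually_mono)
  show "transp l2_rel"
    unfolding transp_def l2_rel_def by (auto elim: eventually_elim2)
qed

text \<open>For \<open>'a = complex ^ 'n\<close> the inner product below is the real part of the usual
  sesquilinear one; the norm, hence the topology, is the usual one.\<close>

quotient_type (overloaded) 'a l2 = "real \<Rightarrow> 'a::euclidean_space" / partial: l2_rel
  by (rule part_equivp_l2_rel)

instantiation l2 :: (euclidean_space) real_inner
begin

lift_definition zero_l2 :: "'a l2" is "\<lambda>x. 0"
  by (simp add: l2_rel_def sq_integrable_zero)

lift_definition plus_l2 :: "'a l2 \<Rightarrow> 'a l2 \<Rightarrow> 'a l2" is "\<lambda>f g x. f x + g x"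
  unfolding l2_rel_def by (auto intro: sq_integrable_add elim: eventually_elim2)

lift_definition uminus_l2 :: "'a l2 \<Rightarrow> 'a l2" is "\<lambda>f x. - f x"
  unfolding l2_rel_def by (auto intro: sq_integrable_uminus)

lift_definition minus_l2 :: "'a l2 \<Rightarrow> 'a l2 \<Rightarrow> 'a l2" is "\<lambda>f g x. f x - g x"
  unfolding l2_rel_def by (auto intro: sq_integrable_diff elim: eventually_elim2)

lift_definition scaleR_l2 :: "real \<Rightarrow> 'a l2 \<Rightarrow> 'a l2" is "\<lambda>c f x. c *\<^sub>R f x"
  unfolding l2_rel_def by (auto intro: sq_integrable_scaleR elim: eventually_mono)

lift_definition inner_l2 :: "'a l2 \<Rightarrow> 'a l2 \<Rightarrow> real" is
  "\<lambda>f g. integral\<^sup>L lebesgue (\<lambda>x. f x \<bullet> g x)"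
proof -
  fix f f' g g' :: "real \<Rightarrow> 'a"
  assume *: "l2_rel f f'" "l2_rel g g'"
  show "integral\<^sup>L lebesgue (\<lambda>x. f x \<bullet> g x) = integral\<^sup>L lebesgue (\<lambda>x. f' x \<bullet> g' x)"
  proof (rule integral_cong_AE)
    show "AE x in lebesgue. f x \<bullet> g x = f' x \<bullet> g' x"
      using * unfolding l2_rel_def by (auto elim: eventually_elim2)
  qed (use * in \<open>auto simp: l2_rel_def intro!: borel_measurable_integrable integrable_inner_sq_integrable\<close>)
qed

definition norm_l2 :: "'a l2 \<Rightarrow> real" where
  "norm_l2 u = sqrt (inner u u)"

definition sgn_l2 :: "'a l2 \<Rightarrow> 'a l2" where
  "sgn_l2 u = scaleR (inverse (norm u)) u"

definition dist_l2 :: "'a l2 \<Rightarrow> 'a l2 \<Rightarrow> real" where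
  "dist_l2 u v = norm (u - v)"

definition uniformity_l2 :: "('a l2 \<times> 'a l2) filter" where
  "uniformity_l2 = (INF e\<in>{0 <..}. principal {(u, v). dist u v < e})"

definition open_l2 :: "'a l2 set \<Rightarrow> bool" where
  "open_l2 S \<longleftrightarrow> (\<forall>u\<in>S. \<forall>\<^sub>F (u', v) in uniformity. u' = u \<longrightarrow> v \<in> S)"

instance
proof
  fix u v w :: "'a l2" and a b :: real
  show "u + v + w = u + (v + w)"
    by transfer (auto simp: l2_rel_def add.assoc intro: sq_integrable_add)
  show "u + v = v + u"
    by transfer (auto simp: l2_rel_def add.commute intro: sq_integrable_add)
  show "0 + u = u"
    by transfer (auto simp: l2_rel_def)
  show "- u + u = 0"
    by transfer (auto simp: l2_rel_def sq_integrable_zero)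
  show "u - v = u + - v"
    by transfer (auto simp: l2_rel_def intro: sq_integrable_diff)
  show "a *\<^sub>R (u + v) = a *\<^sub>R u + a *\<^sub>R v"
    by transfer (auto simp: l2_rel_def scaleR_add_right
        intro!: sq_integrable_scaleR sq_integrable_add)
  show "(a + b) *\<^sub>R u = a *\<^sub>R u + b *\<^sub>R u"
    by transfer (auto simp: l2_rel_def scaleR_add_left
        intro!: sq_integrable_scaleR sq_integrable_add)
  show "a *\<^sub>R b *\<^sub>R u = (a * b) *\<^sub>R u"
    by transfer (auto simp: l2_rel_def intro: sq_integrable_scaleR)
  show "1 *\<^sub>R u = u"
    by transfer (auto simp: l2_rel_def)
  show "dist u v = norm (u - v)"
    by (rule dist_l2_def)
  show "sgn u = scaleR (inverse (norm u)) u"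
    by (rule sgn_l2_def)
  show "norm u = sqrt (u \<bullet> u)"
    by (rule norm_l2_def)
  show "(uniformity :: ('a l2 \<times> 'a l2) filter) = (INF e\<in>{0 <..}. principal {(u, v). dist u v < e})"
    by (rule uniformity_l2_def)
  show "open U = (\<forall>u\<in>U. \<forall>\<^sub>F (u', v) in uniformity. u' = u \<longrightarrow> v \<in> U)" for U :: "'a l2 set"
    by (rule open_l2_def)
  show "u \<bullet> v = v \<bullet> u"
    by transfer (simp add: inner_commute)
  show "(u + v) \<bullet> w = u \<bullet> w + v \<bullet> w"
    by transfer (simp add: l2_rel_def inner_add_left integrable_inner_sq_integrable)
  show "(a *\<^sub>R u) \<bullet> v = a * (u \<bullet> v)"
    by transfer simp
  show "0 \<le> u \<bullet> u"
    by transfer simp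
  show "u \<bullet> u = 0 \<longleftrightarrow> u = 0"
    by transfer
      (auto simp: l2_rel_def sq_integrable_zero integrable_inner_sq_integrable
        integral_nonneg_eq_0_iff_AE)
qed

end


section \<open>Dirac type operators\<close>

definition locally_integrable :: "(real \<Rightarrow> 'a::euclidean_space) \<Rightarrow> bool" where
  "locally_integrable f \<longleftrightarrow> (\<forall>K. compact K \<longrightarrow> f absolutely_integrable_on K)"

text \<open>The members \<open>K\<close> of \<open>D\<close> are the closed intervals \<open>[Inf K, Sup K]\<close>, nonempty but possibly
  degenerate, with pairwise disjoint interiors.\<close>

definition abs_continuous_on_interval :: "real \<Rightarrow> real \<Rightarrow> (real \<Rightarrow> 'a::real_normed_vector) \<Rightarrow> bool" where
  "abs_continuous_on_interval a b f \<longleftrightarrow>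
     (\<forall>\<epsilon>>0. \<exists>\<delta>>0. \<forall>D. D division_of \<Union>D \<and> \<Union>D \<subseteq> {a..b} \<and> (\<Sum>K\<in>D. Sup K - Inf K) < \<delta>
        \<longrightarrow> (\<Sum>K\<in>D. norm (f (Sup K) - f (Inf K))) < \<epsilon>)"

definition AC_loc :: "(real \<Rightarrow> 'a::real_normed_vector) set" where
  "AC_loc = {f. \<forall>a b. abs_continuous_on_interval a b f}"

definition conj_transpose :: "complex ^ 'n ^ 'm \<Rightarrow> complex ^ 'm ^ 'n" where
  "conj_transpose A = (\<chi> i j. cnj (A $ j $ i))"

text \<open>A locally absolutely continuous function is differentiable only almost everywhere, so
  the expression \<open>J y' + Q y\<close> is a partial function.  \<open>dirac_expr J Q y z\<close> says that
  it is defined and equal to \<open>z\<close> almost everywhere.\<close>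

definition dirac_expr ::
  "complex ^ 'n ^ 'n \<Rightarrow> (real \<Rightarrow> complex ^ 'n ^ 'n) \<Rightarrow>
   (real \<Rightarrow> complex ^ 'n) \<Rightarrow> (real \<Rightarrow> complex ^ 'n) \<Rightarrow> bool" where
  "dirac_expr J Q y z \<longleftrightarrow>
     (AE x in lebesgue. \<exists>y'. (y has_vector_derivative y') (at x) \<and> z x = J *v y' + Q x *v y x)"

text \<open>Operators in the Hilbert space are given by their graphs.\<close>

definition D_max ::
  "complex ^ 'n ^ 'n \<Rightarrow> (real \<Rightarrow> complex ^ 'n ^ 'n) \<Rightarrow>
   ((complex ^ 'n) l2 \<times> (complex ^ 'n) l2) set" where
  "D_max J Q =
     {(abs_l2 y, abs_l2 z) | y z.
        y \<in> sq_integrable \<and> y \<in> AC_loc \<and> dirac_expr J Q y z \<and> z \<in> sq_integrable}"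

definition compactly_supported :: "(real \<Rightarrow> 'a::real_normed_vector) \<Rightarrow> bool" where
  "compactly_supported y \<longleftrightarrow> compact (closure {x. y x \<noteq> 0})"

text \<open>The closure of an operator is the closure of its graph; \<open>abs_l2 y\<close> lies in the domain of
  the restricted operator if its locally absolutely continuous representative \<open>y\<close> has
  compact support.\<close>

definition D_min ::
  "complex ^ 'n ^ 'n \<Rightarrow> (real \<Rightarrow> complex ^ 'n ^ 'n) \<Rightarrow>
   ((complex ^ 'n) l2 \<times> (complex ^ 'n) l2) set" where
  "D_min J Q =
     closure {(u, v) \<in> D_max J Q.
       \<exists>y. u = abs_l2 y \<and> y \<in> sq_integrable \<and> y \<in> AC_loc \<and> compactly_supported y}"

end

theory Submission
  imports Defs
begin

text \<open>
The two inclusions have different reasons.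

A function \<open>y\<close> in the domain of the maximal operator is approximated in the graph norm by
\<open>\<phi>\<^sub>R y\<close>, where \<open>\<phi>\<^sub>R\<close> is a scalar cutoff function supported in \<open>[-R, R]\<close> with
\<open>\<bar>\<phi>\<^sub>R'\<bar> \<le> 4 / R\<close>.  Scalars commute with \<open>J\<close> and \<open>Q\<close>, so
\<open>D (\<phi>\<^sub>R y) = \<phi>\<^sub>R D y + \<phi>\<^sub>R' J y\<close>, and the only error term is
\<open>\<phi>\<^sub>R' J y\<close>, whose norm is of order \<open>1 / R\<close>.  This is where the order one of the differential
expression enters; lemma \<open>D_max_subset_D_min\<close> carries it out.

Conversely, the minimal operator lies in the maximal one because the latter is closed, lemma
\<open>closed_D_max\<close>.  As \<open>J\<close> is invertible, elements of the graph solve the integral equation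
\<open>y t - y s = \<integral> J\<^sup>-\<^sup>1 (z - Q y)\<close>.  On intervals over which \<open>Q\<close> has a small integral the term
with \<open>Q\<close> can be absorbed, and compactness then bounds \<open>\<bar>y\<bar>\<close> on every bounded interval by the graph
norm, lemma \<open>maximal_pair_bound_on_interval\<close>.  Hence convergence in the graph norm implies pointwise
convergence and local uniform boundedness of the absolutely continuous representatives, and
dominated convergence carries the integral equation over to the limit.

The passage between the differential and the integral equation rests on two facts about the line: an
absolutely continuous function that is differentiable almost everywhere is the integral of its
derivative, lemma \<open>abs_continuous_fundamental_theorem\<close>, and an indefinite integral is absolutely
continuous with the integrand as its derivative almost everywhere.
\<close>

section \<open>Absolutely continuous functions and integration\<close>

lemma division_of_real_intervals:
  fixes K :: "real set"
  assumes "D division_of S" "K \<in> D"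
  shows "K = {Inf K..Sup K}" "Inf K \<le> Sup K"
proof -
  obtain u v where K: "K = cbox u v" "K \<noteq> {}"
    using division_ofD(3,4)[OF assms] by blast
  then have "u \<le> v" by simp
  with K show "K = {Inf K..Sup K}" "Inf K \<le> Sup K" by simp_all
qed

lemma sum_lengths_division:
  fixes D :: "real set set"
  assumes "D division_of S"
  shows "(\<Sum>K\<in>D. Sup K - Inf K) = measure lebesgue S"
proof -
  have "(\<Sum>K\<in>D. Sup K - Inf K) = (\<Sum>K\<in>D. measure lebesgue K)"
  proof (rule sum.cong[OF refl])
    fix K assume "K \<in> D"
    note K = division_of_real_intervals[OF assms this]
    have "measure lebesgue {Inf K..Sup K} = Sup K - Inf K" using K(2) by simp
    with arg_cong[OF K(1), of "measure lebesgue"] show "Sup K - Inf K = measure lebesgue K" by linarith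
  qed
  then show ?thesis using content_division[OF assms] by simp
qed

lemma abs_continuous_on_intervalD:
  assumes "abs_continuous_on_interval a b f" "0 < e"
  shows "\<exists>\<delta>>0. \<forall>D. D division_of \<Union>D \<longrightarrow> \<Union>D \<subseteq> {a..b} \<longrightarrow> (\<Sum>K\<in>D. Sup K - Inf K) < \<delta>
       \<longrightarrow> (\<Sum>K\<in>D. norm (f (Sup K) - f (Inf K))) < e"
  using assms(1)[unfolded abs_continuous_on_interval_def, rule_format, OF assms(2)]
  by (elim ex_forward conj_forward) simp_all

lemma abs_continuous_on_interval_imp_continuous:
  assumes "abs_continuous_on_interval a b f"
  shows "continuous_on {a..b} f"
proof -
  have "\<exists>\<delta>>0. \<forall>x\<in>{a..b}. \<forall>y\<in>{a..b}. dist y x < \<delta> \<longrightarrow> dist (f y) (f x) < e" if e: "0 < e" for e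
  proof -
    obtain \<delta> where \<delta>: "0 < \<delta>" and "\<forall>D. D division_of \<Union>D \<longrightarrow> \<Union>D \<subseteq> {a..b} \<longrightarrow>
        (\<Sum>K\<in>D. Sup K - Inf K) < \<delta> \<longrightarrow> (\<Sum>K\<in>D. norm (f (Sup K) - f (Inf K))) < e"
      using abs_continuous_on_intervalD[OF assms e] by (elim exE conjE)
    note small = this(2)[rule_format]
    have *: "norm (f v - f u) < e" if "u \<le> v" "{u..v} \<subseteq> {a..b}" "v - u < \<delta>" for u v
    proof -
      have "{{u..v}} division_of \<Union>{{u..v}}"
        using that(1) division_of_self[of u v] by simp
      from small[OF this] that show ?thesis by simp
    qed
    show ?thesis
    proof (intro exI conjI ballI impI)
      fix x y assume xy: "x \<in> {a..b}" "y \<in> {a..b}" "dist y x < \<delta>"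
      show "dist (f y) (f x) < e"
      proof (cases "x \<le> y")
        case True
        with xy *[of x y] show ?thesis by (simp add: dist_norm)
      next
        case False
        with xy *[of y x] show ?thesis by (simp add: dist_norm norm_minus_commute)
      qed
    qed (fact \<delta>)
  qed
  then show ?thesis unfolding continuous_on_iff by blast
qed

text \<open>A gauge argument.  Where the derivative exists, fine cells reproduce the increment of \<open>f\<close> up to
a multiple of their length.  The cells tagged in the null set \<open>N\<close> lie in an open set of measure less
than \<open>\<delta>\<close>, so absolute continuity makes the sum of their increments small; on \<open>N\<close> the integrand is
replaced by \<open>0\<close>, which does not affect the integral.\<close>

lemma abs_continuous_fundamental_theorem:
  fixes f :: "real \<Rightarrow> 'a::banach"
  assumes "a \<le> b" and ac: "abs_continuous_on_interval a b f" and N: "negligible N"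
    and deriv: "\<And>x. x \<in> {a..b} - N \<Longrightarrow> (f has_vector_derivative f' x) (at x within {a..b})"
  shows "(f' has_integral (f b - f a)) {a..b}"
proof -
  define g where "g x = (if x \<in> N then 0 else f' x)" for x
  have "(g has_integral (f b - f a)) {a..b}"
    unfolding has_integral_real
  proof (intro allI impI)
    fix e :: real assume e: "0 < e"
    define c where "c = e / (2 * (b - a + 1))"
    have c: "0 < c" "c * (b - a) < e / 2"
      using e \<open>a \<le> b\<close> by (auto simp: c_def field_simps)
    obtain \<delta> where \<delta>: "0 < \<delta>" and "\<forall>D. D division_of \<Union>D \<longrightarrow> \<Union>D \<subseteq> {a..b} \<longrightarrow>
        (\<Sum>K\<in>D. Sup K - Inf K) < \<delta> \<longrightarrow> (\<Sum>K\<in>D. norm (f (Sup K) - f (Inf K))) < e / 2"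
      using abs_continuous_on_intervalD[OF ac half_gt_zero[OF e]] by (elim exE conjE)
    note small = this(2)[rule_format]
    have Nnull: "N \<in> null_sets lebesgue" using N by (simp add: negligible_iff_null_sets)
    obtain U where U: "open U" "N \<subseteq> U" "U - N \<in> lmeasurable" "emeasure lebesgue (U - N) < ennreal \<delta>"
      using sets_lebesgue_outer_open[of N \<delta>] Nnull \<delta> by blast
    have Nlm: "N \<in> lmeasurable" using N negligible_imp_measurable by blast
    have Ulm: "U \<in> lmeasurable"
      using fmeasurable.Un[OF U(3) Nlm] U(2) by (simp add: Un_absorb2)
    have "measure lebesgue (U - N) < \<delta>"
      using U(3,4) \<delta> by (simp add: emeasure_eq_measure2 ennreal_less_iff)
    moreover have "measure lebesgue (U - N) = measure lebesgue U"
      using Nnull Ulm by (intro measure_Diff_null_set) auto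
    ultimately have Um: "measure lebesgue U < \<delta>" by simp
    have "\<forall>x. \<exists>d>0. x \<in> {a..b} - N \<longrightarrow>
         (\<forall>y\<in>{a..b}. norm (y-x) < d \<longrightarrow> norm (f y - f x - (y-x) *\<^sub>R f' x) \<le> c * norm (y-x))"
      using deriv[unfolded has_vector_derivative_def has_derivative_within_alt] c(1) by blast
    then obtain d where d: "\<And>x. 0 < d x"
                 "\<And>x y. \<lbrakk>x \<in> {a..b} - N; y \<in> {a..b}; norm (y-x) < d x\<rbrakk>
                        \<Longrightarrow> norm (f y - f x - (y-x) *\<^sub>R f' x) \<le> c * norm (y-x)"
      by metis
    \<comment> \<open>A cell tagged in \<open>N\<close> is forced into the thin set \<open>U\<close>; any other cell is forced close
      enough to its tag for the derivative to control the increment.\<close>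
    define \<gamma> where "\<gamma> x = (if x \<in> N then U else ball x (d x))" for x
    show "\<exists>\<gamma>. gauge \<gamma> \<and> (\<forall>p. p tagged_division_of {a..b} \<and> \<gamma> fine p \<longrightarrow>
        norm ((\<Sum>(x, K)\<in>p. measure lborel K *\<^sub>R g x) - (f b - f a)) < e)"
    proof (intro exI conjI allI impI; (elim conjE)?)
      show "gauge \<gamma>" using U d(1) by (auto simp: \<gamma>_def gauge_def)
    next
      fix p assume p: "p tagged_division_of {a..b}" and fine: "\<gamma> fine p"
      have fp: "finite p" using p by blast
      define p1 where "p1 = {(x, K) \<in> p. x \<in> N}"
      define p2 where "p2 = {(x, K) \<in> p. x \<notin> N}"
      have p12: "p = p1 \<union> p2" "p1 \<inter> p2 = {}" "finite p1" "finite p2" "p1 \<subseteq> p" "p2 \<subseteq> p"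
        using fp by (auto simp: p1_def p2_def intro: rev_finite_subset)
      have interval: "\<exists>u v. u \<le> v \<and> K = {u..v} \<and> x \<in> {u..v} \<and> {u..v} \<subseteq> {a..b}" if "(x, K) \<in> p" for x K
        using tagged_division_ofD(2,3,4)[OF p that] by auto
      have fba: "f b - f a = (\<Sum>(x,K)\<in>p. f(Sup K) - f(Inf K))"
        using additive_tagged_division_1[where f= f] \<open>a \<le> b\<close> p by auto
      have ba: "b - a = (\<Sum>(x,K)\<in>p. Sup K - Inf K)"
        using additive_tagged_division_1[where f= "\<lambda>x. x"] \<open>a \<le> b\<close> p by auto
      have "norm (\<Sum>(x, K) \<in> p2. (measure lborel K *\<^sub>R g x) - (f (Sup K) - f (Inf K)))
          \<le> (\<Sum>(x,K)\<in>p2. c * (Sup K - Inf K))"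
      proof (rule sum_norm_le, safe)
        fix x K assume xK: "(x, K) \<in> p2"
        then have xN: "x \<notin> N" and xp: "(x, K) \<in> p" by (auto simp: p2_def)
        obtain u v where uv: "u \<le> v" "K = {u..v}" "x \<in> {u..v}" "{u..v} \<subseteq> {a..b}"
          using interval[OF xp] by blast
        have "K \<subseteq> ball x (d x)" using fineD[OF fine xp] xN by (simp add: \<gamma>_def)
        then have "u \<in> ball x (d x)" "v \<in> ball x (d x)" using uv(1,2) by auto
        then have "norm (u - x) < d x" "norm (v - x) < d x"
          by (simp_all add: dist_real_def abs_minus_commute)
        then have *: "norm (f u - f x - (u-x) *\<^sub>R f' x) \<le> c * norm (u-x)"
          "norm (f v - f x - (v-x) *\<^sub>R f' x) \<le> c * norm (v-x)"
          using d(2)[of x u] d(2)[of x v] uv xN by auto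
        have eq: "(v - u) *\<^sub>R f' x - (f v - f u) = (f u - f x - (u - x) *\<^sub>R f' x) - (f v - f x - (v - x) *\<^sub>R f' x)"
          by (simp add: algebra_simps)
        have "norm ((v - u) *\<^sub>R f' x - (f v - f u)) \<le> c * norm (u-x) + c * norm (v-x)"
          unfolding eq
          using * norm_triangle_ineq4[of "f u - f x - (u - x) *\<^sub>R f' x" "f v - f x - (v - x) *\<^sub>R f' x"] by linarith
        also have "\<dots> = c * (v - u)" using uv by (simp add: algebra_simps)
        finally show "norm (measure lborel K *\<^sub>R g x - (f (Sup K) - f (Inf K))) \<le> c * (Sup K - Inf K)"
          using uv xN by (simp add: g_def)
      qed
      also have "\<dots> \<le> (\<Sum>(x,K)\<in>p. c * (Sup K - Inf K))"
        using interval c(1) by (intro sum_mono2 fp p12) fastforce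
      also have "\<dots> = c * (b - a)"
        unfolding ba by (simp add: sum_distrib_left case_prod_unfold)
      also have "\<dots> < e / 2" by (rule c)
      finally have part2: "norm (\<Sum>(x, K) \<in> p2. (measure lborel K *\<^sub>R g x) - (f (Sup K) - f (Inf K))) < e / 2" .
      define D where "D = snd ` p1"
      have p1div: "p1 tagged_division_of \<Union>D"
        unfolding D_def
        by (rule tagged_partial_division_of_Union_self, rule tagged_partial_division_subset)
           (use p p12 in \<open>auto simp: tagged_division_of_def\<close>)
      then have D: "D division_of \<Union>D"
        unfolding D_def using division_of_tagged_division by blast
      have DU: "\<Union>D \<subseteq> U" using fineD[OF fine] by (fastforce simp: D_def p1_def \<gamma>_def)
      have Dab: "\<Union>D \<subseteq> {a..b}" using interval by (fastforce simp: D_def p1_def)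
      have "(\<Sum>K\<in>D. Sup K - Inf K) \<le> measure lebesgue U"
        unfolding sum_lengths_division[OF D]
        by (rule measure_mono_fmeasurable[OF DU _ Ulm])
           (use D lmeasurable_division in blast)
      then have "(\<Sum>K\<in>D. norm (f (Sup K) - f (Inf K))) < e / 2"
        using Um by (intro small D Dab) simp
      moreover have "(\<Sum>K\<in>D. norm (f (Sup K) - f (Inf K))) = (\<Sum>(x,K)\<in>p1. norm (f (Sup K) - f (Inf K)))"
      proof -
        \<comment> \<open>Two tags of one cell would make its interior empty, hence the cell a single point.\<close>
        have "inj_on snd p1"
        proof (rule inj_onI, clarsimp)
          fix x y K assume xy: "(x, K) \<in> p1" "(y, K) \<in> p1"
          obtain u v where uv: "u \<le> v" "K = {u..v}" "x \<in> {u..v}"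
            using interval[of x K] xy p12(5) by blast
          have y: "y \<in> {u..v}" using tagged_division_ofD(2)[OF p1div xy(2)] uv by simp
          show "x = y"
          proof (rule ccontr)
            assume "x \<noteq> y"
            then have "interior K = {}"
              using tagged_division_ofD(5)[OF p1div xy(1) xy(2)] by auto
            then show False using uv y \<open>x \<noteq> y\<close> by auto
          qed
        qed
        then show ?thesis by (simp add: D_def sum.reindex case_prod_unfold)
      qed
      moreover have "norm (\<Sum>(x, K) \<in> p1. (measure lborel K *\<^sub>R g x) - (f (Sup K) - f (Inf K)))
          \<le> (\<Sum>(x,K)\<in>p1. norm (f (Sup K) - f (Inf K)))"
        by (rule sum_norm_le) (auto simp: p1_def g_def norm_minus_commute)
      ultimately have part1: "norm (\<Sum>(x, K) \<in> p1. (measure lborel K *\<^sub>R g x) - (f (Sup K) - f (Inf K))) < e / 2"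
        by simp
      have "(\<Sum>(x, K)\<in>p. measure lborel K *\<^sub>R g x) - (f b - f a)
         = (\<Sum>(x, K)\<in>p. (measure lborel K *\<^sub>R g x) - (f (Sup K) - f (Inf K)))"
        unfolding fba by (simp add: sum_subtractf case_prod_unfold)
      also have "\<dots> = (\<Sum>(x, K)\<in>p1. (measure lborel K *\<^sub>R g x) - (f (Sup K) - f (Inf K)))
          + (\<Sum>(x, K)\<in>p2. (measure lborel K *\<^sub>R g x) - (f (Sup K) - f (Inf K)))"
        unfolding p12(1) by (rule sum.union_disjoint) (use p12 in auto)
      finally show "norm ((\<Sum>(x, K)\<in>p. measure lborel K *\<^sub>R g x) - (f b - f a)) < e"
        using norm_add_less[OF part1 part2] by simp
    qed
  qed
  then show ?thesis
    by (rule has_integral_spike[OF N, rotated]) (auto simp: g_def)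
qed

text \<open>The integrand is split as \<open>min (norm g) n\<close> plus a remainder.  By dominated convergence the remainder
has a small integral over all of \<open>{a..b}\<close> for large \<open>n\<close>, while the bounded part is controlled by
the total length of the cells.\<close>

lemma abs_continuous_indefinite_integral:
  fixes F :: "real \<Rightarrow> 'a::euclidean_space"
  assumes g: "g absolutely_integrable_on {a..b}"
    and F: "\<And>u v. a \<le> u \<Longrightarrow> u \<le> v \<Longrightarrow> v \<le> b \<Longrightarrow> F v - F u = integral {u..v} g"
  shows "abs_continuous_on_interval a b F"
  unfolding abs_continuous_on_interval_def
proof (intro allI impI)
  fix e :: real assume e: "0 < e"
  define h where "h n x = min (norm (g x)) (real n)" for n x
  have gi: "(\<lambda>x. norm (g x)) absolutely_integrable_on {a..b}"
    using g absolutely_integrable_norm by (simp add: o_def)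
  have hi: "h n integrable_on {a..b}" for n
  proof -
    have "(\<lambda>x. min (norm (g x)) (real n)) absolutely_integrable_on {a..b}"
      by (rule absolutely_integrable_min_1[OF gi])
         (simp add: absolutely_integrable_continuous_real)
    then show ?thesis unfolding h_def using set_lebesgue_integral_eq_integral(1) by blast
  qed
  have ngi: "(\<lambda>x. norm (g x)) integrable_on {a..b}"
    using gi set_lebesgue_integral_eq_integral(1) by blast
  have "(\<lambda>n. integral {a..b} (h n)) \<longlonglongrightarrow> integral {a..b} (\<lambda>x. norm (g x))"
  proof (rule dominated_convergence(2)[OF hi ngi])
    show "norm (h n x) \<le> norm (g x)" for n x by (simp add: h_def)
    show "(\<lambda>n. h n x) \<longlonglongrightarrow> norm (g x)" for x
    proof (rule tendsto_eventually)
      obtain m where "norm (g x) \<le> real m" using real_arch_simple by blast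
      then show "\<forall>\<^sub>F n in sequentially. h n x = norm (g x)"
        unfolding h_def eventually_sequentially by (intro exI[of _ m]) auto
    qed
  qed
  then obtain n where "norm (integral {a..b} (h n) - integral {a..b} (\<lambda>x. norm (g x))) < e / 2"
    using LIMSEQ_D[of _ _ "e/2"] e by (metis half_gt_zero order_refl)
  moreover have "integral {a..b} (\<lambda>x. norm (g x) - h n x) = integral {a..b} (\<lambda>x. norm (g x)) - integral {a..b} (h n)"
    by (rule integral_diff[OF ngi hi])
  ultimately have tail: "integral {a..b} (\<lambda>x. norm (g x) - h n x) < e / 2"
    by (simp add: abs_if split: if_splits)
  \<comment> \<open>The truncated part contributes at most \<open>n\<close> times the total length of the cells.\<close>
  define \<delta> where "\<delta> = e / (2 * (real n + 1))"
  have \<delta>: "0 < \<delta>" "real n * \<delta> < e / 2" using e by (auto simp: \<delta>_def field_simps)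
  show "\<exists>\<delta>>0. \<forall>D. D division_of \<Union>D \<and> \<Union>D \<subseteq> {a..b} \<and> (\<Sum>K\<in>D. Sup K - Inf K) < \<delta>
        \<longrightarrow> (\<Sum>K\<in>D. norm (F (Sup K) - F (Inf K))) < e"
  proof (intro exI conjI allI impI; (elim conjE)?)
    show "0 < \<delta>" by fact
  next
    fix D :: "real set set"
    assume D: "D division_of \<Union>D" and Dab: "\<Union>D \<subseteq> {a..b}" and len: "(\<Sum>K\<in>D. Sup K - Inf K) < \<delta>"
    define r where "r x = norm (g x) - h n x" for x
    have ri: "r integrable_on {a..b}" unfolding r_def by (intro integrable_diff ngi hi)
    have rK: "r integrable_on K" if "K \<in> D" for K
    proof -
      obtain u v where K: "K = cbox u v" using division_ofD(4)[OF D \<open>K \<in> D\<close>] by blast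
      have "cbox u v \<subseteq> {a..b}" using K that Dab by blast
      then show ?thesis using integrable_on_subinterval[of r "{a..b}" u v] ri K by simp
    qed
    have step: "norm (F (Sup K) - F (Inf K)) \<le> integral K r + real n * (Sup K - Inf K)" if "K \<in> D" for K
    proof -
      define u v where "u = Inf K" "v = Sup K"
      have K: "K = {u..v}" and uv: "u \<le> v" using division_of_real_intervals[OF D that] by (simp_all add: u_v_def)
      have sub: "{u..v} \<subseteq> {a..b}" using K that Dab by blast
      then have auvb: "a \<le> u" "v \<le> b" using uv by auto
      have i: "g integrable_on {u..v}" "(\<lambda>x. norm (g x)) integrable_on {u..v}" "h n integrable_on {u..v}"
        by (intro integrable_on_subinterval[OF _ sub] ngi hi set_lebesgue_integral_eq_integral(1)[OF g])+
      have "norm (F v - F u) = norm (integral {u..v} g)" using F auvb uv by simp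
      also have "\<dots> \<le> integral {u..v} (\<lambda>x. norm (g x))"
        by (rule integral_norm_bound_integral[OF i(1,2)]) simp
      also have "\<dots> = integral {u..v} r + integral {u..v} (h n)"
        unfolding r_def using integral_diff[OF i(2,3)] by simp
      also have "integral {u..v} (h n) \<le> integral {u..v} (\<lambda>x. real n)"
        by (rule integral_le[OF i(3)]) (auto simp: h_def)
      also have "\<dots> = real n * (v - u)" using uv by simp
      finally show ?thesis by (simp only: K[symmetric] u_v_def[symmetric])
    qed
    have "(\<Sum>K\<in>D. norm (F (Sup K) - F (Inf K))) \<le> (\<Sum>K\<in>D. integral K r + real n * (Sup K - Inf K))"
      by (rule sum_mono[OF step])
    also have "\<dots> = integral (\<Union>D) r + real n * (\<Sum>K\<in>D. Sup K - Inf K)"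
      using integral_combine_division_bottomup[OF D rK] by (simp add: sum.distrib sum_distrib_left)
    also have "\<dots> \<le> integral {a..b} r + real n * \<delta>"
    proof (rule add_mono)
      show "integral (\<Union>D) r \<le> integral {a..b} r"
        by (rule integral_subset_le[OF Dab _ ri]) (use integrable_combine_division[OF D rK] in \<open>auto simp: r_def h_def\<close>)
    qed (use len in \<open>simp add: mult_left_mono\<close>)
    also have "\<dots> < e" using tail \<delta>(2) unfolding r_def by simp
    finally show "(\<Sum>K\<in>D. norm (F (Sup K) - F (Inf K))) < e" .
  qed
qed

text \<open>The Lebesgue differentiation theorem on the line.  The averages of \<open>g\<close> over the intervals
\<open>[x, x + h]\<close> converge to \<open>g x\<close> almost everywhere; the intervals \<open>[x - h, x]\<close> are handled by
the same fact for the reflected function \<open>\<lambda>x. g (- x)\<close>.\<close>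

lemma has_vector_derivative_indefinite_integral:
  fixes F :: "real \<Rightarrow> 'a::euclidean_space"
  assumes g: "\<And>a b. g integrable_on {a..b}"
    and F: "\<And>u v. u \<le> v \<Longrightarrow> F v - F u = integral {u..v} g"
  obtains N where "negligible N" "\<And>x. x \<notin> N \<Longrightarrow> (F has_vector_derivative g x) (at x)"
proof -
  obtain N where N: "negligible N" and right: "\<And>x e. \<lbrakk>x \<notin> N; 0 < e\<rbrakk> \<Longrightarrow>
      \<exists>d>0. \<forall>h. 0 < h \<and> h < d \<longrightarrow> norm (integral {x..x + h} g /\<^sub>R h - g x) < e"
    using integrable_ccontinuous_explicit[of g] g by auto
  have "(\<lambda>x. g (- x)) integrable_on {a..b}" for a b
    using Henstock_Kurzweil_Integration.integrable_reflect_real[where f=g and a="-b" and b="-a"] g by simp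
  then obtain M where M: "negligible M" and left: "\<And>x e. \<lbrakk>x \<notin> M; 0 < e\<rbrakk> \<Longrightarrow>
      \<exists>d>0. \<forall>h. 0 < h \<and> h < d \<longrightarrow> norm (integral {x..x + h} (\<lambda>x. g (- x)) /\<^sub>R h - g (- x)) < e"
    using integrable_ccontinuous_explicit[of "\<lambda>x. g (- x)"] by auto
  have *: "norm (F (x + s * h) - F x - (s * h) *\<^sub>R g x) \<le> e * \<bar>s * h\<bar>"
    if "0 < h" "s = 1 \<or> s = -1" "norm (integral I g /\<^sub>R h - g x) < e"
      "F (x + s * h) - F x = s *\<^sub>R integral I g" for x h s e I
  proof -
    have "F (x + s * h) - F x - (s * h) *\<^sub>R g x = (s * h) *\<^sub>R (integral I g /\<^sub>R h - g x)"
      using that(1) by (simp add: that(4) scaleR_diff_right)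
    then have "norm (F (x + s * h) - F x - (s * h) *\<^sub>R g x) = \<bar>s * h\<bar> * norm (integral I g /\<^sub>R h - g x)"
      by simp
    also have "\<dots> \<le> \<bar>s * h\<bar> * e" using that(3) by (intro mult_left_mono) auto
    finally show ?thesis by (simp add: mult.commute)
  qed
  show thesis
  proof (rule that)
    show "negligible (N \<union> uminus ` M)"
      using N M by (intro negligible_Un negligible_differentiable_image_negligible)
        (auto intro!: derivative_intros)
    fix x assume x: "x \<notin> N \<union> uminus ` M"
    then have xM: "- x \<notin> M" by (metis UnI2 imageI minus_minus)
    show "(F has_vector_derivative g x) (at x)"
      unfolding has_vector_derivative_def has_derivative_at_alt
    proof (intro conjI allI impI)
      fix e :: real assume e: "0 < e"
      obtain d where d: "0 < d" "\<And>h. 0 < h \<and> h < d \<Longrightarrow> norm (integral {x..x + h} g /\<^sub>R h - g x) < e"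
        using right[of x e] x e by auto
      obtain d' where d': "0 < d'"
        "\<And>h. 0 < h \<and> h < d' \<Longrightarrow> norm (integral {-x..-x + h} (\<lambda>x. g (- x)) /\<^sub>R h - g x) < e"
        using left[of "-x" e] xM e by auto
      show "\<exists>d>0. \<forall>y. norm (y - x) < d \<longrightarrow> norm (F y - F x - (y - x) *\<^sub>R g x) \<le> e * norm (y - x)"
      proof (intro exI[of _ "min d d'"] conjI allI impI)
        fix y assume y: "norm (y - x) < min d d'"
        consider "y = x" | "x < y" | "y < x" by linarith
        then show "norm (F y - F x - (y - x) *\<^sub>R g x) \<le> e * norm (y - x)"
        proof cases
          case 2
          then show ?thesis
            using *[of "y - x" 1 "{x..y}" x e] d(2)[of "y - x"] y F[of x y] by auto
        next
          case 3
          have "integral {-x..-x + (x - y)} (\<lambda>x. g (- x)) = integral {y..x} g"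
            using Henstock_Kurzweil_Integration.integral_reflect_real[where f=g and a=y and b=x] by simp
          moreover have "F y - F x = - integral {y..x} g"
            using F[of y x] 3 by (metis less_imp_le minus_diff_eq)
          ultimately show ?thesis
            using *[of "x - y" "-1" "{y..x}" x e] d'(2)[of "x - y"] y 3 by auto
        qed simp
      qed (use d d' in auto)
    qed (rule bounded_linear_scaleR_left)
  qed
qed

section \<open>Operations on absolutely continuous functions\<close>

text \<open>Differences, products and Lipschitz functions satisfy an increment bound of this form, so their
absolute continuity needs no separate argument about divisions.\<close>

lemma abs_continuous_on_interval_comparison:
  assumes g: "abs_continuous_on_interval a b g" and h: "abs_continuous_on_interval a b h"
    and le: "\<And>u v. u \<in> {a..b} \<Longrightarrow> v \<in> {a..b} \<Longrightarrow>
      norm (f v - f u) \<le> C * (norm (g v - g u) + norm (h v - h u))"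
  shows "abs_continuous_on_interval a b f"
  unfolding abs_continuous_on_interval_def
proof (intro allI impI)
  fix e :: real assume e: "0 < e"
  define c where "c = e / (\<bar>C\<bar> + 1) / 2"
  have "c + c = e / (\<bar>C\<bar> + 1)" unfolding c_def by (rule field_sum_of_halves)
  moreover have "\<bar>C\<bar> * (e / (\<bar>C\<bar> + 1)) < e" using e by (simp add: divide_simps)
  moreover have "0 < c" using e by (simp add: c_def add_nonneg_pos)
  ultimately have c: "0 < c" "\<bar>C\<bar> * (c + c) < e" by simp_all
  obtain \<delta>1 where "0 < \<delta>1" and "\<forall>D. D division_of \<Union>D \<longrightarrow> \<Union>D \<subseteq> {a..b} \<longrightarrow>
      (\<Sum>K\<in>D. Sup K - Inf K) < \<delta>1 \<longrightarrow> (\<Sum>K\<in>D. norm (g (Sup K) - g (Inf K))) < c"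
    using abs_continuous_on_intervalD[OF g c(1)] by (elim exE conjE)
  note \<delta>1 = this(1) this(2)[rule_format]
  obtain \<delta>2 where "0 < \<delta>2" and "\<forall>D. D division_of \<Union>D \<longrightarrow> \<Union>D \<subseteq> {a..b} \<longrightarrow>
      (\<Sum>K\<in>D. Sup K - Inf K) < \<delta>2 \<longrightarrow> (\<Sum>K\<in>D. norm (h (Sup K) - h (Inf K))) < c"
    using abs_continuous_on_intervalD[OF h c(1)] by (elim exE conjE)
  note \<delta>2 = this(1) this(2)[rule_format]
  show "\<exists>\<delta>>0. \<forall>D. D division_of \<Union>D \<and> \<Union>D \<subseteq> {a..b} \<and> (\<Sum>K\<in>D. Sup K - Inf K) < \<delta>
        \<longrightarrow> (\<Sum>K\<in>D. norm (f (Sup K) - f (Inf K))) < e"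
  proof (intro exI[of _ "min \<delta>1 \<delta>2"] conjI allI impI; (elim conjE)?)
    show "0 < min \<delta>1 \<delta>2" using \<delta>1(1) \<delta>2(1) by simp
  next
    fix D :: "real set set"
    assume D: "D division_of \<Union>D" and Dab: "\<Union>D \<subseteq> {a..b}"
      and len: "(\<Sum>K\<in>D. Sup K - Inf K) < min \<delta>1 \<delta>2"
    have "(\<Sum>K\<in>D. norm (f (Sup K) - f (Inf K)))
        \<le> (\<Sum>K\<in>D. \<bar>C\<bar> * (norm (g (Sup K) - g (Inf K)) + norm (h (Sup K) - h (Inf K))))"
    proof (rule sum_mono)
      fix K assume K: "K \<in> D"
      have "{Inf K..Sup K} \<subseteq> {a..b}"
        using division_of_real_intervals(1)[OF D K] Dab K by blast
      then have "Inf K \<in> {a..b}" "Sup K \<in> {a..b}"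
        using division_of_real_intervals(2)[OF D K] by auto
      then have "norm (f (Sup K) - f (Inf K)) \<le> C * (norm (g (Sup K) - g (Inf K)) + norm (h (Sup K) - h (Inf K)))"
        by (rule le)
      also have "\<dots> \<le> \<bar>C\<bar> * (norm (g (Sup K) - g (Inf K)) + norm (h (Sup K) - h (Inf K)))"
        by (rule mult_right_mono) auto
      finally show "norm (f (Sup K) - f (Inf K)) \<le> \<bar>C\<bar> * (norm (g (Sup K) - g (Inf K)) + norm (h (Sup K) - h (Inf K)))" .
    qed
    also have "\<dots> = \<bar>C\<bar> * ((\<Sum>K\<in>D. norm (g (Sup K) - g (Inf K))) + (\<Sum>K\<in>D. norm (h (Sup K) - h (Inf K))))"
      by (simp add: sum.distrib flip: sum_distrib_left)
    also have "\<dots> \<le> \<bar>C\<bar> * (c + c)"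
      using \<delta>1(2)[OF D Dab] \<delta>2(2)[OF D Dab] len by (intro mult_left_mono add_mono) auto
    also have "\<dots> < e" by (rule c)
    finally show "(\<Sum>K\<in>D. norm (f (Sup K) - f (Inf K))) < e" .
  qed
qed

lemma AC_loc_continuous:
  assumes "f \<in> AC_loc"
  shows "continuous_on S f"
proof -
  have "isCont f x" for x
  proof (rule continuous_on_interior)
    show "continuous_on {x - 1..x + 1} f"
      using assms by (auto simp: AC_loc_def intro: abs_continuous_on_interval_imp_continuous)
  qed simp
  then show ?thesis by (simp add: continuous_at_imp_continuous_on)
qed

lemma AC_loc_diff:
  assumes "f \<in> AC_loc" "g \<in> AC_loc"
  shows "(\<lambda>x. f x - g x) \<in> AC_loc"
proof -
  have "norm (f v - g v - (f u - g u)) \<le> 1 * (norm (f v - f u) + norm (g v - g u))" for u v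
    using norm_triangle_ineq4[of "f v - f u" "g v - g u"] by (simp add: algebra_simps)
  then show ?thesis
    using abs_continuous_on_interval_comparison[of _ _ f g "\<lambda>x. f x - g x" 1] assms
    by (simp add: AC_loc_def)
qed

lemma AC_loc_lipschitz:
  fixes f :: "real \<Rightarrow> 'a::real_normed_vector"
  assumes "\<And>u v. norm (f v - f u) \<le> C * \<bar>v - u\<bar>"
  shows "f \<in> AC_loc"
proof -
  have id: "abs_continuous_on_interval a b (\<lambda>x::real. x)" for a b
    unfolding abs_continuous_on_interval_def
  proof (intro allI impI exI conjI)
    fix e :: real and D :: "real set set"
    assume e: "0 < e" and "D division_of \<Union>D \<and> \<Union>D \<subseteq> {a..b} \<and> (\<Sum>K\<in>D. Sup K - Inf K) < e"
    moreover have "(\<Sum>K\<in>D. norm (Sup K - Inf K)) = (\<Sum>K\<in>D. Sup K - Inf K)" if "D division_of \<Union>D"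
      using division_of_real_intervals(2)[OF that] by (intro sum.cong) auto
    ultimately show "(\<Sum>K\<in>D. norm (Sup K - Inf K)) < e" by simp
  qed
  have "norm (f v - f u) \<le> (\<bar>C\<bar> / 2) * (norm (v - u) + norm (v - u))" for u v
    using order_trans[OF assms[of v u] mult_right_mono[of C "\<bar>C\<bar>" "\<bar>v - u\<bar>"]] by simp
  then show ?thesis
    unfolding AC_loc_def using abs_continuous_on_interval_comparison[OF id id] by blast
qed

lemma AC_loc_scaleR:
  fixes f :: "real \<Rightarrow> real" and g :: "real \<Rightarrow> 'a::real_normed_vector"
  assumes f: "f \<in> AC_loc" and g: "g \<in> AC_loc"
  shows "(\<lambda>x. f x *\<^sub>R g x) \<in> AC_loc"
  unfolding AC_loc_def mem_Collect_eq
proof (intro allI)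
  fix a b
  have bdd: "bounded (f ` {a..b})" "bounded (g ` {a..b})"
    using f g by (auto intro!: compact_imp_bounded compact_continuous_image AC_loc_continuous)
  obtain A where A: "\<And>x. x \<in> {a..b} \<Longrightarrow> norm (f x) \<le> A"
    using bdd(1) unfolding bounded_iff by blast
  obtain B where B: "\<And>x. x \<in> {a..b} \<Longrightarrow> norm (g x) \<le> B"
    using bdd(2) unfolding bounded_iff by blast
  have le: "norm (f v *\<^sub>R g v - f u *\<^sub>R g u) \<le> (\<bar>A\<bar> + \<bar>B\<bar>) * (norm (f v - f u) + norm (g v - g u))"
    if "u \<in> {a..b}" "v \<in> {a..b}" for u v
  proof -
    have "f v *\<^sub>R g v - f u *\<^sub>R g u = f v *\<^sub>R (g v - g u) + (f v - f u) *\<^sub>R g u"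
      by (simp add: algebra_simps)
    then have "norm (f v *\<^sub>R g v - f u *\<^sub>R g u) \<le> norm (f v) * norm (g v - g u) + norm (f v - f u) * norm (g u)"
      by (metis norm_triangle_ineq norm_scaleR real_norm_def)
    also have "\<dots> \<le> (\<bar>A\<bar> + \<bar>B\<bar>) * norm (g v - g u) + norm (f v - f u) * (\<bar>A\<bar> + \<bar>B\<bar>)"
      using A[OF that(2)] B[OF that(1)] by (intro add_mono mult_mono) auto
    finally show ?thesis by (simp add: algebra_simps)
  qed
  have "abs_continuous_on_interval a b f" "abs_continuous_on_interval a b g"
    using f g by (simp_all add: AC_loc_def)
  then show "abs_continuous_on_interval a b (\<lambda>x. f x *\<^sub>R g x)"
    by (rule abs_continuous_on_interval_comparison) (rule le)
qed

section \<open>A differentiable cutoff function\<close>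

lemma has_real_derivative_max_0_squared:
  "((\<lambda>t. (max 0 t)\<^sup>2) has_real_derivative 2 * max 0 t) (at (t::real))"
proof -
  consider "t < 0" | "t = 0" | "t > 0" by linarith
  then show ?thesis
  proof cases
    case 1
    have "((\<lambda>t. 0) has_real_derivative 0) (at t)" by simp
    then have "((\<lambda>t. (max 0 t)\<^sup>2) has_real_derivative 0) (at t)"
      by (rule has_field_derivative_transform_within_open[of _ _ _ "{..<0}"]) (use 1 in auto)
    then show ?thesis using 1 by simp
  next
    case 2
    have "((\<lambda>h::real. (max 0 (0 + h))\<^sup>2 / h) \<longlongrightarrow> 0) (at 0)"
    proof (rule Lim_null_comparison)
      show "\<forall>\<^sub>F h in at 0. norm ((max 0 (0 + h))\<^sup>2 / h) \<le> \<bar>h::real\<bar>"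
        by (auto simp: eventually_at_filter max_def power2_eq_square)
      show "((\<lambda>h::real. \<bar>h\<bar>) \<longlongrightarrow> 0) (at 0)"
        by (intro tendsto_eq_intros | simp)+
    qed
    then show ?thesis using 2 by (simp add: DERIV_def)
  next
    case 3
    have "((\<lambda>t. t\<^sup>2) has_real_derivative 2 * t) (at t)"
      by (auto intro!: derivative_eq_intros)
    then have "((\<lambda>t. (max 0 t)\<^sup>2) has_real_derivative 2 * t) (at t)"
      by (rule has_field_derivative_transform_within_open[of _ _ _ "{0<..}"]) (use 3 in auto)
    then show ?thesis using 3 by simp
  qed
qed

text \<open>The outer square makes the function differentiable also at the points \<open>\<plusminus>R\<close>, where
\<open>1 - (x / R)\<^sup>2\<close> changes sign.\<close>

definition cutoff :: "real \<Rightarrow> real \<Rightarrow> real" where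
  "cutoff R x = (max 0 (1 - (x / R)\<^sup>2))\<^sup>2"

definition cutoff_deriv :: "real \<Rightarrow> real \<Rightarrow> real" where
  "cutoff_deriv R x = 2 * max 0 (1 - (x / R)\<^sup>2) * (- 2 * x / R\<^sup>2)"

lemma cutoff_has_derivative:
  "(cutoff R has_real_derivative cutoff_deriv R x) (at x)"
proof -
  have "((\<lambda>x. 1 - (x / R)\<^sup>2) has_real_derivative - 2 * x / R\<^sup>2) (at x)"
    by (cases "R = 0") (auto intro!: derivative_eq_intros simp: power2_eq_square)
  from DERIV_chain2[OF has_real_derivative_max_0_squared this]
  show ?thesis by (simp add: cutoff_def[abs_def] cutoff_deriv_def)
qed

text \<open>The derivative vanishes outside \<open>[-R, R]\<close>, and inside the factor \<open>\<bar>x\<bar>\<close> is at most \<open>R\<close>.\<close>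

lemma cutoff_deriv_bound:
  assumes "0 < R"
  shows "\<bar>cutoff_deriv R x\<bar> \<le> 4 / R"
proof (cases "\<bar>x\<bar> < R")
  case True
  have "max 0 (1 - (x / R)\<^sup>2) \<le> 1" by auto
  then have "\<bar>cutoff_deriv R x\<bar> \<le> 2 * 1 * (2 * R / R\<^sup>2)"
    using True assms unfolding cutoff_deriv_def abs_mult
    by (intro mult_mono) (auto simp: divide_simps abs_mult)
  then show ?thesis using assms by (simp add: power2_eq_square)
next
  case False
  then have "1 \<le> (x / R)\<^sup>2"
    using assms abs_le_square_iff[of R x] by (simp add: power_divide)
  then show ?thesis using assms by (simp add: cutoff_deriv_def)
qed

lemma cutoff_bounds: "0 \<le> cutoff R x" "cutoff R x \<le> 1"
  by (auto simp: cutoff_def intro!: power_le_one)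

lemma cutoff_eq_0:
  assumes "0 < R" "R \<le> \<bar>x\<bar>"
  shows "cutoff R x = 0"
proof -
  have "1 \<le> (x / R)\<^sup>2"
    using assms abs_le_square_iff[of R x] by (simp add: power_divide)
  then show ?thesis by (simp add: cutoff_def)
qed

lemma cutoff_tendsto_1: "(\<lambda>k. cutoff (real (Suc k)) x) \<longlonglongrightarrow> 1"
proof -
  have "(\<lambda>k. x / real (Suc k)) \<longlonglongrightarrow> 0"
    using tendsto_mult[OF tendsto_const LIMSEQ_inverse_real_of_nat, of x] by (simp add: divide_inverse)
  then have "(\<lambda>k. cutoff (real (Suc k)) x) \<longlonglongrightarrow> (max 0 (1 - 0\<^sup>2))\<^sup>2"
    unfolding cutoff_def by (intro tendsto_intros)
  then show ?thesis by simp
qed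

lemma cutoff_AC_loc:
  assumes "0 < R"
  shows "cutoff R \<in> AC_loc"
proof (rule AC_loc_lipschitz)
  fix u v
  have "norm (cutoff R v - cutoff R u) \<le> 4 / R * norm (v - u)"
    by (rule field_differentiable_bound[of UNIV "cutoff R" "cutoff_deriv R"])
       (use cutoff_has_derivative cutoff_deriv_bound[OF assms] in auto)
  then show "norm (cutoff R v - cutoff R u) \<le> 4 / R * \<bar>v - u\<bar>" by simp
qed

lemma cutoff_continuous: "continuous_on UNIV (cutoff R)" "continuous_on UNIV (cutoff_deriv R)"
  unfolding cutoff_def[abs_def] cutoff_deriv_def[abs_def] by (auto intro!: continuous_intros simp: divide_inverse)

lemma compactly_supported_cutoff:
  assumes "0 < R"
  shows "compactly_supported (\<lambda>x. cutoff R x *\<^sub>R y x)"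
proof -
  have "{x. cutoff R x *\<^sub>R y x \<noteq> 0} \<subseteq> {-R..R}"
    using cutoff_eq_0[OF assms] by (force simp: abs_le_iff not_le)
  then have "bounded {x. cutoff R x *\<^sub>R y x \<noteq> 0}"
    using bounded_subset bounded_closed_interval by blast
  then show ?thesis by (simp add: compactly_supported_def compact_closure)
qed

section \<open>Square-integrable functions\<close>

lemma l2_rel_refl: "f \<in> sq_integrable \<Longrightarrow> l2_rel f f"
  by (simp add: l2_rel_def)

lemma abs_l2_eq_iff:
  assumes "f \<in> sq_integrable" "g \<in> sq_integrable"
  shows "abs_l2 f = abs_l2 g \<longleftrightarrow> (AE x in lebesgue. f x = g x)"
  using Quotient3_rel[OF Quotient3_l2, of f g] assms by (simp add: l2_rel_def)

lemma abs_l2_cases: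
  obtains f where "f \<in> sq_integrable" "u = abs_l2 f"
proof -
  have "l2_rel (rep_l2 u) (rep_l2 u)" "abs_l2 (rep_l2 u) = u"
    using Quotient3_rep_reflp[OF Quotient3_l2] Quotient3_abs_rep[OF Quotient3_l2] by metis+
  then show thesis using that[of "rep_l2 u"] by (simp add: l2_rel_def)
qed

lemma diff_abs_l2:
  assumes "f \<in> sq_integrable" "g \<in> sq_integrable"
  shows "abs_l2 f - abs_l2 g = abs_l2 (\<lambda>x. f x - g x)"
  using assms by (simp add: minus_l2.abs_eq l2_rel_refl)

lemma inner_abs_l2:
  assumes "f \<in> sq_integrable" "g \<in> sq_integrable"
  shows "inner (abs_l2 f) (abs_l2 g) = (\<integral>x. f x \<bullet> g x \<partial>lebesgue)"
  using assms by (simp add: inner_l2.abs_eq l2_rel_refl)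

lemma norm_abs_l2:
  assumes "f \<in> sq_integrable"
  shows "norm (abs_l2 f) = sqrt (\<integral>x. (norm (f x))\<^sup>2 \<partial>lebesgue)"
  using assms by (simp add: norm_eq_sqrt_inner[where 'a="'a l2"] inner_abs_l2 power2_norm_eq_inner)

lemma sq_integrable_comparison:
  assumes "f \<in> borel_measurable lebesgue" "g \<in> sq_integrable"
    and "\<And>x. norm (f x) \<le> C * norm (g x)"
  shows "f \<in> sq_integrable"
proof -
  have "integrable lebesgue (\<lambda>x. (norm (f x))\<^sup>2)"
  proof (rule Bochner_Integration.integrable_bound)
    show "integrable lebesgue (\<lambda>x. C\<^sup>2 * (norm (g x))\<^sup>2)"
      using assms by (simp add: sq_integrable_def)
    show "(\<lambda>x. (norm (f x))\<^sup>2) \<in> borel_measurable lebesgue" using assms(1) by measurable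
    have "(norm (f x))\<^sup>2 \<le> C\<^sup>2 * (norm (g x))\<^sup>2" for x
      using power_mono[OF assms(3) norm_ge_zero, of x 2] by (simp add: power_mult_distrib)
    then show "AE x in lebesgue. norm ((norm (f x))\<^sup>2) \<le> norm (C\<^sup>2 * (norm (g x))\<^sup>2)" by simp
  qed
  with assms(1) show ?thesis by (simp add: sq_integrable_def)
qed

lemma sq_integrable_bounded_continuous_scaleR:
  fixes \<phi> :: "real \<Rightarrow> real"
  assumes "continuous_on UNIV \<phi>" "\<And>x. \<bar>\<phi> x\<bar> \<le> C" "f \<in> sq_integrable"
  shows "(\<lambda>x. \<phi> x *\<^sub>R f x) \<in> sq_integrable"
proof (rule sq_integrable_comparison[OF _ assms(3)])
  have "\<phi> \<in> borel_measurable lborel"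
    using borel_measurable_continuous_onI[OF assms(1)] by simp
  then have "\<phi> \<in> borel_measurable lebesgue" by (rule measurable_completion)
  then show "(\<lambda>x. \<phi> x *\<^sub>R f x) \<in> borel_measurable lebesgue"
    using assms(3) by (auto simp: sq_integrable_def intro!: borel_measurable_scaleR)
  show "norm (\<phi> x *\<^sub>R f x) \<le> C * norm (f x)" for x
    using assms(2)[of x] by (simp add: mult_right_mono)
qed

lemma sq_integrable_bounded_linear:
  assumes "bounded_linear T" "f \<in> sq_integrable"
  shows "(\<lambda>x. T (f x)) \<in> sq_integrable"
proof -
  obtain C where C: "\<And>x. norm (T x) \<le> norm x * C" using bounded_linear.bounded[OF assms(1)] by blast
  show ?thesis
  proof (rule sq_integrable_comparison[OF _ assms(2)])
    show "(\<lambda>x. T (f x)) \<in> borel_measurable lebesgue"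
      using assms borel_measurable_continuous_on[of T f lebesgue]
      by (simp add: sq_integrable_def linear_continuous_on)
    show "norm (T (f x)) \<le> C * norm (f x)" for x using C by (simp add: mult.commute)
  qed
qed

lemma tendsto_abs_l2:
  assumes f: "\<And>k. f k \<in> sq_integrable" and f0: "f0 \<in> sq_integrable"
    and g: "integrable lebesgue g" and le: "\<And>k x. (norm (f k x - f0 x))\<^sup>2 \<le> g x"
    and lim: "\<And>x. (\<lambda>k. f k x) \<longlonglongrightarrow> f0 x"
  shows "(\<lambda>k. abs_l2 (f k)) \<longlonglongrightarrow> abs_l2 f0"
proof -
  have d: "(\<lambda>x. f k x - f0 x) \<in> sq_integrable" for k by (rule sq_integrable_diff[OF f f0])
  have "(\<lambda>k. \<integral>x. (norm (f k x - f0 x))\<^sup>2 \<partial>lebesgue) \<longlonglongrightarrow> (\<integral>x. 0 \<partial>(lebesgue :: real measure))"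
  proof (rule integral_dominated_convergence[where w=g])
    show "integrable lebesgue g" by (rule g)
    show "(\<lambda>x. (norm (f k x - f0 x))\<^sup>2) \<in> borel_measurable lebesgue" for k
      using d[of k] by (auto simp: sq_integrable_def intro: borel_measurable_integrable)
    have "(\<lambda>k. (norm (f k x - f0 x))\<^sup>2) \<longlonglongrightarrow> (norm (f0 x - f0 x))\<^sup>2" for x
      by (intro tendsto_intros lim)
    then show "AE x in lebesgue. (\<lambda>k. (norm (f k x - f0 x))\<^sup>2) \<longlonglongrightarrow> 0" by simp
  qed (use le in auto)
  then have "(\<lambda>k. sqrt (\<integral>x. (norm (f k x - f0 x))\<^sup>2 \<partial>lebesgue)) \<longlonglongrightarrow> sqrt (\<integral>x. 0 \<partial>(lebesgue :: real measure))"
    by (rule tendsto_real_sqrt)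
  then have "(\<lambda>k. norm (abs_l2 (f k) - abs_l2 f0)) \<longlonglongrightarrow> 0"
    by (simp add: diff_abs_l2 f f0 norm_abs_l2 d)
  then have "(\<lambda>k. abs_l2 (f k) - abs_l2 f0) \<longlonglongrightarrow> 0" by (rule tendsto_norm_zero_cancel)
  then show ?thesis by (rule LIM_zero_cancel)
qed

section \<open>Approximation by compactly supported functions\<close>

text \<open>The graph of the maximal operator, with functions in place of equivalence classes.  Pointwise values
and derivatives make sense only for the locally absolutely continuous representative \<open>y\<close>.\<close>

definition maximal_pair ::
  "complex ^ 'n ^ 'n \<Rightarrow> (real \<Rightarrow> complex ^ 'n ^ 'n) \<Rightarrow>
   (real \<Rightarrow> complex ^ 'n) \<Rightarrow> (real \<Rightarrow> complex ^ 'n) \<Rightarrow> bool" where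
  "maximal_pair J Q y z \<longleftrightarrow>
     y \<in> sq_integrable \<and> y \<in> AC_loc \<and> dirac_expr J Q y z \<and> z \<in> sq_integrable"

lemma D_max_eq: "D_max J Q = {(abs_l2 y, abs_l2 z) | y z. maximal_pair J Q y z}"
  by (simp add: D_max_def maximal_pair_def)

text \<open>Multiplication by a scalar function commutes with \<open>J\<close> and with \<open>Q x\<close>, so the product rule produces
only one additional term, \<open>J *v y\<close> times the derivative of the cutoff.\<close>

lemma maximal_pair_cutoff:
  assumes "maximal_pair J Q y z" and R: "0 < R"
  shows "maximal_pair J Q (\<lambda>x. cutoff R x *\<^sub>R y x)
           (\<lambda>x. cutoff R x *\<^sub>R z x + cutoff_deriv R x *\<^sub>R (J *v y x))"
  unfolding maximal_pair_def
proof (intro conjI)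
  have y: "y \<in> sq_integrable" "y \<in> AC_loc" and z: "z \<in> sq_integrable" and D: "dirac_expr J Q y z"
    using assms by (auto simp: maximal_pair_def)
  have c: "\<bar>cutoff R x\<bar> \<le> 1" for x using cutoff_bounds[of R x] by simp
  show "(\<lambda>x. cutoff R x *\<^sub>R y x) \<in> sq_integrable"
    by (rule sq_integrable_bounded_continuous_scaleR[OF cutoff_continuous(1) c y(1)])
  show "(\<lambda>x. cutoff R x *\<^sub>R y x) \<in> AC_loc"
    by (rule AC_loc_scaleR[OF cutoff_AC_loc[OF R] y(2)])
  show "(\<lambda>x. cutoff R x *\<^sub>R z x + cutoff_deriv R x *\<^sub>R (J *v y x)) \<in> sq_integrable"
    by (intro sq_integrable_add sq_integrable_bounded_continuous_scaleR[OF cutoff_continuous(1) c z]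
        sq_integrable_bounded_continuous_scaleR[OF cutoff_continuous(2) cutoff_deriv_bound[OF R]]
        sq_integrable_bounded_linear[OF matrix_vector_mul_bounded_linear y(1)])
  show "dirac_expr J Q (\<lambda>x. cutoff R x *\<^sub>R y x)
      (\<lambda>x. cutoff R x *\<^sub>R z x + cutoff_deriv R x *\<^sub>R (J *v y x))"
    using D unfolding dirac_expr_def
  proof eventually_elim
    case (elim x)
    then obtain y' where y': "(y has_vector_derivative y') (at x)" "z x = J *v y' + Q x *v y x" by blast
    have "((\<lambda>x. cutoff R x *\<^sub>R y x) has_vector_derivative cutoff R x *\<^sub>R y' + cutoff_deriv R x *\<^sub>R y x) (at x)"
      by (rule has_vector_derivative_scaleR[OF cutoff_has_derivative y'(1)])
    moreover have "A *v (c *\<^sub>R w) = c *\<^sub>R (A *v w)" for A :: "complex ^ 'a ^ 'a" and c :: real and w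
      by (rule linear_scale[OF bounded_linear.linear[OF matrix_vector_mul_bounded_linear]])
    ultimately show ?case
      using y'(2) by (intro exI conjI) (assumption, simp add: matrix_vector_right_distrib scaleR_right_distrib)
  qed
qed

text \<open>The functions \<open>\<phi>\<^sub>k y\<close> with cutoffs \<open>\<phi>\<^sub>k\<close> of radius \<open>k + 1\<close> converge to \<open>y\<close> in the graph norm:
the additional term \<open>\<phi>\<^sub>k' J y\<close> is bounded by \<open>4 / (k + 1)\<close> times the square-integrable
function \<open>\<bar>J y\<bar>\<close>.\<close>

lemma D_max_subset_D_min: "D_max J Q \<subseteq> D_min J Q"
proof
  fix p assume "p \<in> D_max J Q"
  then obtain y z where p: "p = (abs_l2 y, abs_l2 z)" and yz: "maximal_pair J Q y z"
    by (auto simp: D_max_eq)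
  define yk where "yk k x = cutoff (real (Suc k)) x *\<^sub>R y x" for k x
  define zk where "zk k x = cutoff (real (Suc k)) x *\<^sub>R z x + cutoff_deriv (real (Suc k)) x *\<^sub>R (J *v y x)" for k x
  have k: "maximal_pair J Q (yk k) (zk k)" for k
    unfolding yk_def[abs_def] zk_def[abs_def] by (rule maximal_pair_cutoff[OF yz]) simp
  have Jy: "(\<lambda>x. J *v y x) \<in> sq_integrable"
    using yz by (auto simp: maximal_pair_def intro: sq_integrable_bounded_linear)
  have c1: "\<bar>cutoff R x - 1\<bar> \<le> 1" for R x using cutoff_bounds[of R x] by simp
  have d4: "\<bar>cutoff_deriv (real (Suc k)) x\<bar> \<le> 4 / real (Suc k)" for k x
    by (rule cutoff_deriv_bound) simp
  have "(\<lambda>k. abs_l2 (yk k)) \<longlonglongrightarrow> abs_l2 y"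
  proof (rule tendsto_abs_l2)
    show "yk k \<in> sq_integrable" "y \<in> sq_integrable" "integrable lebesgue (\<lambda>x. (norm (y x))\<^sup>2)" for k
      using k[of k] yz by (auto simp: maximal_pair_def sq_integrable_def)
    show "(norm (yk k x - y x))\<^sup>2 \<le> (norm (y x))\<^sup>2" for k x
    proof -
      have "yk k x - y x = (cutoff (real (Suc k)) x - 1) *\<^sub>R y x" by (simp add: yk_def scaleR_left_diff_distrib)
      then have "norm (yk k x - y x) \<le> norm (y x)"
        using mult_right_mono[OF c1 norm_ge_zero, of "real (Suc k)" x "y x"] by simp
      then show ?thesis by (rule power_mono) simp
    qed
    show "(\<lambda>k. yk k x) \<longlonglongrightarrow> y x" for x
      using tendsto_scaleR[OF cutoff_tendsto_1 tendsto_const, of x "y x"] by (simp add: yk_def)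
  qed
  moreover have "(\<lambda>k. abs_l2 (zk k)) \<longlonglongrightarrow> abs_l2 z"
  proof (rule tendsto_abs_l2)
    show "zk k \<in> sq_integrable" "z \<in> sq_integrable" for k
      using k[of k] yz by (auto simp: maximal_pair_def sq_integrable_def)
    \<comment> \<open>The coefficients come from \<open>(\<alpha> + 4\<beta>)\<^sup>2 \<le> 2\<alpha>\<^sup>2 + 32\<beta>\<^sup>2\<close>, as \<open>4 / (k + 1) \<le> 4\<close>.\<close>
    show "integrable lebesgue (\<lambda>x. 2 * (norm (z x))\<^sup>2 + 32 * (norm (J *v y x))\<^sup>2)"
      using yz Jy by (auto simp: maximal_pair_def sq_integrable_def)
    show "(norm (zk k x - z x))\<^sup>2 \<le> 2 * (norm (z x))\<^sup>2 + 32 * (norm (J *v y x))\<^sup>2" for k x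
    proof -
      have "zk k x - z x = (cutoff (real (Suc k)) x - 1) *\<^sub>R z x + cutoff_deriv (real (Suc k)) x *\<^sub>R (J *v y x)"
        by (simp add: zk_def scaleR_left_diff_distrib)
      also have "norm \<dots> \<le> 1 * norm (z x) + 4 * norm (J *v y x)"
      proof (rule norm_triangle_le, rule add_mono)
        show "norm ((cutoff (real (Suc k)) x - 1) *\<^sub>R z x) \<le> 1 * norm (z x)"
          unfolding norm_scaleR by (rule mult_right_mono[OF c1]) simp
        have "4 / real (Suc k) \<le> 4" by (simp add: divide_simps)
        then show "norm (cutoff_deriv (real (Suc k)) x *\<^sub>R (J *v y x)) \<le> 4 * norm (J *v y x)"
          unfolding norm_scaleR by (intro mult_right_mono order_trans[OF d4]) auto
      qed
      finally have "(norm (zk k x - z x))\<^sup>2 \<le> (norm (z x) + 4 * norm (J *v y x))\<^sup>2"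
        by (intro power_mono) auto
      also have "\<dots> \<le> 2 * (norm (z x))\<^sup>2 + 32 * (norm (J *v y x))\<^sup>2"
        using sum_squares_bound[of "norm (z x)" "4 * norm (J *v y x)"]
        by (simp add: power2_sum power_mult_distrib)
      finally show ?thesis .
    qed
    show "(\<lambda>k. zk k x) \<longlonglongrightarrow> z x" for x
    proof -
      have "(\<lambda>k. 4 / real (Suc k)) \<longlonglongrightarrow> 0"
        using tendsto_mult[OF tendsto_const LIMSEQ_inverse_real_of_nat, of 4] by (simp add: divide_inverse)
      then have "(\<lambda>k. cutoff_deriv (real (Suc k)) x) \<longlonglongrightarrow> 0"
        by (rule Lim_null_comparison[rotated]) (use d4 in auto)
      then have "(\<lambda>k. zk k x) \<longlonglongrightarrow> 1 *\<^sub>R z x + 0 *\<^sub>R (J *v y x)"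
        unfolding zk_def by (intro tendsto_intros cutoff_tendsto_1)
      then show ?thesis by simp
    qed
  qed
  ultimately have lim: "(\<lambda>k. (abs_l2 (yk k), abs_l2 (zk k))) \<longlonglongrightarrow> p"
    unfolding p by (rule tendsto_Pair)
  show "p \<in> D_min J Q"
    unfolding D_min_def closure_sequential
  proof (intro exI conjI allI)
    fix i
    have "compactly_supported (yk i)"
      unfolding yk_def[abs_def] by (rule compactly_supported_cutoff) simp
    then show "(abs_l2 (yk i), abs_l2 (zk i)) \<in> {(u, v) \<in> D_max J Q.
       \<exists>y. u = abs_l2 y \<and> y \<in> sq_integrable \<and> y \<in> AC_loc \<and> compactly_supported y}"
      using k[of i] by (auto simp: D_max_eq maximal_pair_def)
  qed (rule lim)
qed

section \<open>Integrals of square-integrable functions over bounded intervals\<close>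

lemma sq_integrable_absolutely_integrable_on:
  assumes "f \<in> sq_integrable"
  shows "f absolutely_integrable_on {a..b}"
proof -
  have fm: "f \<in> borel_measurable (lebesgue_on {a..b})"
    using assms by (simp add: sq_integrable_def measurable_restrict_space1)
  have f2: "(\<lambda>x. (norm (f x))\<^sup>2) integrable_on {a..b}"
  proof -
    have "set_integrable lebesgue {a..b} (\<lambda>x. (norm (f x))\<^sup>2)"
      unfolding set_integrable_def using assms
      by (intro integrable_mult_indicator) (auto simp: sq_integrable_def)
    then show ?thesis by (rule set_lebesgue_integral_eq_integral(1))
  qed
  show ?thesis
  proof (rule measurable_bounded_by_integrable_imp_absolutely_integrable[OF fm])
    show "(\<lambda>x. 1 + (norm (f x))\<^sup>2) integrable_on {a..b}"
      by (rule integrable_add[OF integrable_const_ivl f2])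
    show "norm (f x) \<le> 1 + (norm (f x))\<^sup>2" for x
    proof -
      have "2 * norm (f x) \<le> (norm (f x))\<^sup>2 + 1" using sum_squares_bound[of "norm (f x)" 1] by simp
      then show ?thesis using norm_ge_zero[of "f x"] by linarith
    qed
  qed simp
qed

text \<open>The Cauchy-Schwarz inequality for \<open>norm f\<close> and the indicator function of \<open>{a..b}\<close>.\<close>

lemma integral_norm_le_norm_abs_l2:
  assumes f: "f \<in> sq_integrable" and ab: "a \<le> b"
  shows "integral {a..b} (\<lambda>x. norm (f x)) \<le> sqrt (b - a) * norm (abs_l2 f)"
proof -
  define F :: "real \<Rightarrow> real" where "F x = norm (f x)" for x
  define I :: "real \<Rightarrow> real" where "I = indicator {a..b}"
  have F: "F \<in> sq_integrable"
    using f by (auto simp: sq_integrable_def F_def[abs_def])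
  have I2: "(I x)\<^sup>2 = I x" for x by (simp add: I_def indicator_def)
  have I: "I \<in> sq_integrable"
    using lmeasurable_iff_integrable[of "{a..b}"]
    by (simp add: sq_integrable_def I2) (simp add: I_def borel_measurable_indicator)
  have "norm (abs_l2 I) = sqrt (b - a)"
    using ab by (simp add: norm_abs_l2[OF I] I2) (simp add: I_def)
  moreover have "norm (abs_l2 F) = norm (abs_l2 f)"
    by (simp add: norm_abs_l2[OF F] norm_abs_l2[OF f] F_def)
  moreover have "inner (abs_l2 I) (abs_l2 F) = integral {a..b} F"
  proof -
    have "F absolutely_integrable_on {a..b}"
      by (rule sq_integrable_absolutely_integrable_on[OF F])
    from set_lebesgue_integral_eq_integral(2)[OF this]
    show ?thesis unfolding inner_abs_l2[OF I F] by (simp add: set_lebesgue_integral_def I_def)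
  qed
  ultimately show ?thesis
    using norm_cauchy_schwarz[of "abs_l2 I" "abs_l2 F"] by (simp add: F_def[abs_def])
qed

text \<open>The mean of \<open>norm f\<close> over the interval is at least \<open>m\<close>.  With \<open>m\<close> the minimum of a continuous
\<open>norm f\<close>, this bounds the minimum by the norm in the Hilbert space.\<close>

lemma norm_abs_l2_lower_bound:
  assumes f: "f \<in> sq_integrable" and ab: "a \<le> b" and m: "0 \<le> m"
    and le: "\<And>x. x \<in> {a..b} \<Longrightarrow> m \<le> norm (f x)"
  shows "m * sqrt (b - a) \<le> norm (abs_l2 f)"
proof -
  have "m * (b - a) = integral {a..b} (\<lambda>x. m)" using ab by simp
  also have "\<dots> \<le> integral {a..b} (\<lambda>x. norm (f x))"
  proof (rule integral_le)
    show "(\<lambda>x. norm (f x)) integrable_on {a..b}"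
      using sq_integrable_absolutely_integrable_on[OF f] by (simp add: absolutely_integrable_on_def)
  qed (use le in auto)
  also have "\<dots> \<le> sqrt (b - a) * norm (abs_l2 f)" by (rule integral_norm_le_norm_abs_l2[OF f ab])
  finally have "m * (b - a) \<le> sqrt (b - a) * norm (abs_l2 f)" .
  moreover have "m * (b - a) = sqrt (b - a) * (m * sqrt (b - a))" using ab by simp
  ultimately have *: "sqrt (b - a) * (m * sqrt (b - a)) \<le> sqrt (b - a) * norm (abs_l2 f)" by linarith
  show ?thesis
  proof (cases "a = b")
    case False
    then have "0 < sqrt (b - a)" using ab by simp
    with * show ?thesis by (simp only: mult_le_cancel_left_pos)
  qed simp
qed

section \<open>The integral equation\<close>

lemma bilinear_matrix_vector_mult:
  "bilinear (\<lambda>v (M :: complex ^ 'n ^ 'm). M *v v)"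
  unfolding bilinear_def
proof (intro conjI allI)
  show "linear (\<lambda>v. M *v v)" for M :: "complex ^ 'n ^ 'm"
    by (rule bounded_linear.linear[OF matrix_vector_mul_bounded_linear])
  show "linear (\<lambda>M :: complex ^ 'n ^ 'm. M *v v)" for v
    by (rule linearI) (simp_all add: matrix_vector_mult_def vec_eq_iff sum.distrib algebra_simps scaleR_sum_right)
qed

lemma absolutely_integrable_matrix_vector_mult:
  fixes Q :: "real \<Rightarrow> complex ^ 'n ^ 'm"
  assumes "locally_integrable Q" "continuous_on UNIV y"
  shows "(\<lambda>x. Q x *v y x) absolutely_integrable_on {a..b}"
proof (rule absolutely_integrable_bounded_measurable_product[OF bilinear_matrix_vector_mult])
  have c: "continuous_on {a..b} y" using assms(2) continuous_on_subset by blast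
  show "y \<in> borel_measurable (lebesgue_on {a..b})"
    by (rule continuous_imp_measurable_on_sets_lebesgue[OF c]) simp
  show "bounded (y ` {a..b})" by (intro compact_imp_bounded compact_continuous_image c) simp
  show "Q absolutely_integrable_on {a..b}" using assms(1) by (simp add: locally_integrable_def)
qed simp

text \<open>Multiplying by the inverse \<open>A\<close> of \<open>J\<close> turns the Dirac equation into \<open>y' = A (z - Q y)\<close> almost
everywhere, which the fundamental theorem for absolutely continuous functions integrates.\<close>

lemma maximal_pair_integral_equation:
  assumes AJ: "A ** J = mat 1" and "maximal_pair J Q y z" and "a \<le> b"
  shows "((\<lambda>x. A *v (z x - Q x *v y x)) has_integral (y b - y a)) {a..b}"
proof -
  have "AE x in lebesgue. \<exists>y'. (y has_vector_derivative y') (at x) \<and> z x = J *v y' + Q x *v y x"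
    and ac: "abs_continuous_on_interval a b y"
    using assms(2) by (auto simp: maximal_pair_def dirac_expr_def AC_loc_def)
  then obtain N where N: "negligible N" and sub:
    "{x. \<not> (\<exists>y'. (y has_vector_derivative y') (at x) \<and> z x = J *v y' + Q x *v y x)} \<subseteq> N"
    by (auto simp: eventually_ae_filter negligible_iff_null_sets)
  show ?thesis
  proof (rule abs_continuous_fundamental_theorem[OF assms(3) ac N])
    fix x assume "x \<in> {a..b} - N"
    then obtain y' where y': "(y has_vector_derivative y') (at x)" "z x = J *v y' + Q x *v y x"
      using sub by blast
    have "A *v (z x - Q x *v y x) = y'"
      by (simp add: y'(2) matrix_vector_mul_assoc AJ)
    then show "(y has_vector_derivative A *v (z x - Q x *v y x)) (at x within {a..b})"
      using y'(1) by (simp add: has_vector_derivative_at_within)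
  qed
qed

lemma maximal_pair_diff:
  assumes "maximal_pair J Q y1 z1" "maximal_pair J Q y2 z2"
  shows "maximal_pair J Q (\<lambda>x. y1 x - y2 x) (\<lambda>x. z1 x - z2 x)"
  unfolding maximal_pair_def
proof (intro conjI)
  have "AE x in lebesgue. \<exists>y'. (y1 has_vector_derivative y') (at x) \<and> z1 x = J *v y' + Q x *v y1 x"
    and "AE x in lebesgue. \<exists>y'. (y2 has_vector_derivative y') (at x) \<and> z2 x = J *v y' + Q x *v y2 x"
    using assms by (simp_all add: maximal_pair_def dirac_expr_def)
  then show "dirac_expr J Q (\<lambda>x. y1 x - y2 x) (\<lambda>x. z1 x - z2 x)"
    unfolding dirac_expr_def
  proof eventually_elim
    case (elim x)
    then obtain y1' y2' where "(y1 has_vector_derivative y1') (at x)" "z1 x = J *v y1' + Q x *v y1 x"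
      "(y2 has_vector_derivative y2') (at x)" "z2 x = J *v y2' + Q x *v y2 x" by blast
    then show ?case
      by (intro exI[of _ "y1' - y2'"] conjI has_vector_derivative_diff)
         (simp_all add: matrix_vector_mult_diff_distrib)
  qed
qed (use assms in \<open>auto simp: maximal_pair_def intro: sq_integrable_diff AC_loc_diff\<close>)

section \<open>Pointwise bounds by the graph norm\<close>

lemma short_interval_small_integral:
  fixes q :: "real \<Rightarrow> real"
  assumes q: "\<And>a b. q integrable_on {a..b}" and e: "0 < e"
  obtains r where "0 < r" "integral {c - r..c + r} q \<le> e"
proof -
  define I where "I x = integral {c - 1..x} q" for x
  have "continuous_on {c - 1..c + 1} I"
    unfolding I_def by (rule indefinite_integral_continuous_1[OF q])
  moreover have "c \<in> {c - 1..c + 1}" by simp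
  moreover have "0 < e / 2" using e by simp
  ultimately have "\<exists>d>0. \<forall>x\<in>{c - 1..c + 1}. dist x c < d \<longrightarrow> dist (I x) (I c) < e / 2"
    unfolding continuous_on_iff by blast
  then obtain d where d: "0 < d" "\<And>x. x \<in> {c - 1..c + 1} \<Longrightarrow> dist x c < d \<Longrightarrow> dist (I x) (I c) < e / 2"
    by blast
  define r where "r = min 1 (d / 2)"
  have r: "0 < r" "r \<le> 1" "r < d" using d(1) by (auto simp: r_def)
  have "integral {c - 1..c - r} q + integral {c - r..c + r} q = integral {c - 1..c + r} q"
    by (rule Henstock_Kurzweil_Integration.integral_combine[OF _ _ q]) (use r in auto)
  then have "integral {c - r..c + r} q = I (c + r) - I (c - r)" by (simp add: I_def)
  also have "\<dots> \<le> e"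
    using d(2)[of "c + r"] d(2)[of "c - r"] r by (simp add: dist_real_def abs_if split: if_splits)
  finally show thesis using that r by blast
qed

lemma locally_integrable_norm_integrable:
  assumes "locally_integrable Q"
  shows "(\<lambda>x. k * norm (Q x)) integrable_on {a..b}"
proof -
  have "Q absolutely_integrable_on {a..b}" using assms by (simp add: locally_integrable_def)
  then have "(\<lambda>x. norm (Q x)) integrable_on {a..b}" by (simp add: absolutely_integrable_on_def)
  then show ?thesis using integrable_cmul[of "\<lambda>x. norm (Q x)" "{a..b}" k] by simp
qed

text \<open>On an interval \<open>I\<close> around \<open>c\<close> so short that the integral of \<open>k * B * norm (Q x)\<close> is at most \<open>1/2\<close>,
the term of the integral equation with \<open>Q y\<close> contributes at most half the maximum of
\<open>norm y\<close> on \<open>I\<close> and can be absorbed on the left-hand side.  What remains bounds the maximum by the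
minimum of \<open>norm y\<close> and the integral of \<open>norm z\<close> over \<open>I\<close>, hence by the graph norm.\<close>

lemma maximal_pair_local_bound:
  fixes J A :: "complex ^ 'n ^ 'n"
  assumes AJ: "A ** J = mat 1" and Q: "locally_integrable Q"
  obtains r C where "0 < r" "0 \<le> C"
    "\<And>y z t. maximal_pair J Q y z \<Longrightarrow> t \<in> {c - r..c + r} \<Longrightarrow>
       norm (y t) \<le> C * (norm (abs_l2 y) + norm (abs_l2 z))"
proof -
  obtain B where B: "0 < B" "\<And>M :: complex ^ 'n ^ 'n. \<And>v. norm (M *v v) \<le> B * norm v * norm M"
    using bilinear_bounded_pos[OF bilinear_matrix_vector_mult] by blast
  define k where "k = B * norm A"
  have k: "0 \<le> k" using B(1) by (simp add: k_def)
  have rhs: "norm (A *v (z - M *v w)) \<le> k * norm z + (k * B * norm M) * norm w" for z w and M :: "complex ^ 'n ^ 'n"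
  proof -
    have "norm (A *v (z - M *v w)) \<le> k * norm (z - M *v w)"
      using B(2)[of A "z - M *v w"] by (simp add: k_def mult_ac)
    also have "\<dots> \<le> k * (norm z + B * norm w * norm M)"
      by (intro mult_left_mono order_trans[OF norm_triangle_ineq4] add_left_mono B(2) k)
    finally show ?thesis by (simp add: algebra_simps)
  qed
  define q where "q x = k * B * norm (Q x)" for x
  have q: "q integrable_on {a..b}" for a b
    unfolding q_def by (rule locally_integrable_norm_integrable[OF Q])
  obtain r where r: "0 < r" and small: "integral {c - r..c + r} q \<le> 1 / 2"
    using short_interval_small_integral[OF q, of "1/2" c] by auto
  define C where "C = 2 / sqrt (2 * r) + 2 * k * sqrt (2 * r)"
  have s2r: "0 < sqrt (2 * r)" using r by simp
  have C: "0 \<le> C" using r k by (simp add: C_def)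
  have "norm (y t) \<le> C * (norm (abs_l2 y) + norm (abs_l2 z))"
    if yz: "maximal_pair J Q y z" and t: "t \<in> {c - r..c + r}" for y z t
  proof -
    let ?I = "{c - r..c + r}"
    have y: "y \<in> sq_integrable" "y \<in> AC_loc" and z: "z \<in> sq_integrable"
      using yz by (auto simp: maximal_pair_def)
    have cont: "continuous_on ?I (\<lambda>x. norm (y x))"
      by (intro continuous_on_norm AC_loc_continuous y)
    \<comment> \<open>The maximum over the interval is compared with the minimum, and the minimum with the
      square integral.\<close>
    obtain t0 where t0: "t0 \<in> ?I" "\<And>x. x \<in> ?I \<Longrightarrow> norm (y x) \<le> norm (y t0)"
      using continuous_attains_sup[OF _ _ cont] r by (metis atLeastatMost_empty_iff2 compact_Icc empty_iff t)
    obtain s0 where s0: "s0 \<in> ?I" "\<And>x. x \<in> ?I \<Longrightarrow> norm (y s0) \<le> norm (y x)"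
      using continuous_attains_inf[OF _ _ cont] r by (metis atLeastatMost_empty_iff2 compact_Icc empty_iff t)
    define h where "h x = k * norm (z x) + q x * norm (y t0)" for x
    have nz: "(\<lambda>x. norm (z x)) integrable_on ?I"
      using sq_integrable_absolutely_integrable_on[OF z] by (simp add: absolutely_integrable_on_def)
    have hi: "h integrable_on ?I"
      unfolding h_def
      using integrable_add[OF integrable_cmul[OF nz, of k] integrable_on_mult_left[OF q]] by simp
    have h0: "0 \<le> h x" for x unfolding h_def q_def using k B(1) by simp
    have step: "norm (y v - y u) \<le> integral ?I h" if uv: "u \<le> v" "u \<in> ?I" "v \<in> ?I" for u v
    proof -
      let ?g = "\<lambda>x. A *v (z x - Q x *v y x)"
      have g: "(?g has_integral (y v - y u)) {u..v}"
        by (rule maximal_pair_integral_equation[OF AJ yz uv(1)])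
      have sub: "{u..v} \<subseteq> ?I" using uv by auto
      have hi': "h integrable_on {u..v}" by (rule integrable_on_subinterval[OF hi sub])
      have "norm (y v - y u) \<le> integral {u..v} h"
        unfolding integral_unique[OF g, symmetric]
      proof (rule Henstock_Kurzweil_Integration.integral_norm_bound_integral[OF _ hi'])
        show "?g integrable_on {u..v}" using g by blast
        fix x assume "x \<in> {u..v}"
        then have "x \<in> ?I" using sub by blast
        then have "q x * norm (y x) \<le> q x * norm (y t0)"
          using t0(2) k B(1) by (intro mult_left_mono) (auto simp: q_def)
        then show "norm (?g x) \<le> h x"
          using rhs[of "z x" "Q x" "y x"] by (simp add: h_def q_def)
      qed
      also have "\<dots> \<le> integral ?I h" using integral_subset_le[OF sub hi' hi] h0 by blast
      finally show ?thesis .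
    qed
    have "norm (y t0 - y s0) \<le> integral ?I h"
    proof (cases "s0 \<le> t0")
      case True then show ?thesis by (rule step[OF _ s0(1) t0(1)])
    next
      case False then show ?thesis using step[of t0 s0] s0(1) t0(1) by (simp add: norm_minus_commute)
    qed
    also have "integral ?I h = k * integral ?I (\<lambda>x. norm (z x)) + integral ?I q * norm (y t0)"
      unfolding h_def
      using integral_add[OF integrable_cmul[OF nz, of k] integrable_on_mult_left[OF q[of "c - r" "c + r"], of "norm (y t0)"]] by simp
    also have "\<dots> \<le> k * (sqrt (2 * r) * norm (abs_l2 z)) + 1 / 2 * norm (y t0)"
      using integral_norm_le_norm_abs_l2[OF z, of "c - r" "c + r"] r small k
      by (intro add_mono mult_left_mono mult_right_mono) (auto simp: algebra_simps)
    finally have "norm (y t0 - y s0) \<le> k * (sqrt (2 * r) * norm (abs_l2 z)) + 1 / 2 * norm (y t0)" .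
    moreover have "norm (y t0) \<le> norm (y s0) + norm (y t0 - y s0)"
      using norm_triangle_sub by blast
    ultimately have "norm (y t0) \<le> 2 * norm (y s0) + 2 * k * sqrt (2 * r) * norm (abs_l2 z)" by simp
    moreover have "norm (y s0) \<le> norm (abs_l2 y) / sqrt (2 * r)"
      using norm_abs_l2_lower_bound[OF y(1), of "c - r" "c + r" "norm (y s0)"] s0(2) r s2r
      by (simp add: pos_le_divide_eq algebra_simps)
    moreover have "norm (y t) \<le> norm (y t0)" by (rule t0(2)[OF t])
    ultimately have "norm (y t) \<le> 2 / sqrt (2 * r) * norm (abs_l2 y) + 2 * k * sqrt (2 * r) * norm (abs_l2 z)"
      by simp
    also have "\<dots> \<le> C * norm (abs_l2 y) + C * norm (abs_l2 z)"
      unfolding C_def using k r by (intro add_mono mult_right_mono) auto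
    finally show ?thesis by (simp add: distrib_left)
  qed
  then show thesis using that[OF r C] by blast
qed

text \<open>Finitely many of the short intervals cover \<open>{a..b}\<close>; the sum of their constants serves all of them.
So point evaluation is continuous for the graph norm, uniformly on bounded intervals.\<close>

lemma maximal_pair_bound_on_interval:
  fixes J A :: "complex ^ 'n ^ 'n"
  assumes AJ: "A ** J = mat 1" and Q: "locally_integrable Q"
  obtains C where "0 \<le> C"
    "\<And>y z t. maximal_pair J Q y z \<Longrightarrow> t \<in> {a..b} \<Longrightarrow>
       norm (y t) \<le> C * (norm (abs_l2 y) + norm (abs_l2 z))"
proof -
  have "\<exists>r C. 0 < r \<and> 0 \<le> C \<and> (\<forall>y z t. maximal_pair J Q y z \<longrightarrow> t \<in> {c - r..c + r} \<longrightarrow>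
       norm (y t) \<le> C * (norm (abs_l2 y) + norm (abs_l2 z)))" for c
    by (rule maximal_pair_local_bound[OF AJ Q, of c]) blast
  then obtain r C where rC: "\<And>c. 0 < r c" "\<And>c. 0 \<le> C c"
    "\<And>c y z t. maximal_pair J Q y z \<Longrightarrow> t \<in> {c - r c..c + r c} \<Longrightarrow>
       norm (y t) \<le> C c * (norm (abs_l2 y) + norm (abs_l2 z))"
    by metis
  obtain F where F: "finite F" "{a..b} \<subseteq> (\<Union>c\<in>F. {c - r c<..<c + r c})"
  proof (rule compactE_image[of "{a..b}" "{a..b}" "\<lambda>c. {c - r c<..<c + r c}"])
    show "{a..b} \<subseteq> (\<Union>c\<in>{a..b}. {c - r c<..<c + r c})" using rC(1) by fastforce
  qed auto
  show thesis
  proof (rule that[of "sum C F"])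
    show "0 \<le> sum C F" by (rule sum_nonneg) (rule rC(2))
    fix y z t assume yz: "maximal_pair J Q y z" and t: "t \<in> {a..b}"
    obtain c where c: "c \<in> F" "t \<in> {c - r c<..<c + r c}" using F(2) t by blast
    then have "norm (y t) \<le> C c * (norm (abs_l2 y) + norm (abs_l2 z))" by (intro rC(3)[OF yz]) auto
    also have "\<dots> \<le> sum C F * (norm (abs_l2 y) + norm (abs_l2 z))"
      using member_le_sum[OF c(1), of C] rC(2) F(1) by (intro mult_right_mono) auto
    finally show "norm (y t) \<le> sum C F * (norm (abs_l2 y) + norm (abs_l2 z))" .
  qed
qed

section \<open>The maximal operator is closed\<close>

lemma tendsto_integral_of_tendsto_abs_l2:
  assumes f: "\<And>k. f k \<in> sq_integrable" and f0: "f0 \<in> sq_integrable"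
    and lim: "(\<lambda>k. abs_l2 (f k)) \<longlonglongrightarrow> abs_l2 f0" and "a \<le> b"
  shows "(\<lambda>k. integral {a..b} (f k)) \<longlonglongrightarrow> integral {a..b} f0"
proof (rule LIM_zero_cancel, rule Lim_null_comparison[OF always_eventually[OF allI]])
  fix k
  have d: "(\<lambda>x. f k x - f0 x) \<in> sq_integrable" by (rule sq_integrable_diff[OF f f0])
  have i: "g integrable_on {a..b}" "(\<lambda>x. norm (g x)) integrable_on {a..b}" if "g \<in> sq_integrable" for g :: "real \<Rightarrow> 'a"
    using sq_integrable_absolutely_integrable_on[OF that] by (auto simp: absolutely_integrable_on_def)
  have "norm (integral {a..b} (f k) - integral {a..b} f0) = norm (integral {a..b} (\<lambda>x. f k x - f0 x))"
    by (simp add: integral_diff i f f0)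
  also have "\<dots> \<le> integral {a..b} (\<lambda>x. norm (f k x - f0 x))"
    by (rule Henstock_Kurzweil_Integration.integral_norm_bound_integral[OF i[OF d]]) simp
  also have "\<dots> \<le> sqrt (b - a) * norm (abs_l2 (\<lambda>x. f k x - f0 x))"
    by (rule integral_norm_le_norm_abs_l2[OF d \<open>a \<le> b\<close>])
  finally show "norm (integral {a..b} (f k) - integral {a..b} f0) \<le> sqrt (b - a) * norm (abs_l2 (f k) - abs_l2 f0)"
    by (simp add: diff_abs_l2 f f0)
next
  have "(\<lambda>k. sqrt (b - a) * norm (abs_l2 (f k) - abs_l2 f0)) \<longlonglongrightarrow> sqrt (b - a) * norm (abs_l2 f0 - abs_l2 f0)"
    by (intro tendsto_intros lim)
  then show "(\<lambda>k. sqrt (b - a) * norm (abs_l2 (f k) - abs_l2 f0)) \<longlonglongrightarrow> 0" by simp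
qed

text \<open>Let \<open>(y\<^sub>k, z\<^sub>k)\<close> converge in the graph norm.  By the bound above the values \<open>y\<^sub>k t\<close> form
Cauchy sequences, with a pointwise limit \<open>w\<close>, and are bounded uniformly on each bounded interval.  The
uniform bound is what makes \<open>Q y\<^sub>k\<close> dominated by a multiple of the locally integrable
\<open>norm (Q x)\<close>, so the integral equation survives in the limit.  It shows that \<open>w\<close> is locally
absolutely continuous and solves the Dirac equation, and \<open>w\<close> is a representative of the limit of the
\<open>y\<^sub>k\<close> in the Hilbert space.\<close>

lemma closed_D_max:
  fixes J :: "complex ^ 'n ^ 'n"
  assumes "invertible J" and Q: "locally_integrable Q"
  shows "closed (D_max J Q)"
  unfolding closed_sequential_limits
proof (intro allI impI, elim conjE)
  obtain A where JA: "J ** A = mat 1" and AJ: "A ** J = mat 1"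
    using assms(1) by (auto simp: invertible_def)
  fix p :: "nat \<Rightarrow> (complex ^ 'n) l2 \<times> (complex ^ 'n) l2" and l
  assume mem: "\<forall>k. p k \<in> D_max J Q" and pl: "p \<longlonglongrightarrow> l"
  from mem have "\<forall>k. \<exists>y z. p k = (abs_l2 y, abs_l2 z) \<and> maximal_pair J Q y z" by (auto simp: D_max_eq)
  then obtain y z where p: "\<And>k. p k = (abs_l2 (y k), abs_l2 (z k))" and mp: "\<And>k. maximal_pair J Q (y k) (z k)"
    by metis
  have y: "y k \<in> sq_integrable" "y k \<in> AC_loc" and z: "z k \<in> sq_integrable" for k
    using mp[of k] by (auto simp: maximal_pair_def)
  obtain u where u: "u \<in> sq_integrable" "fst l = abs_l2 u" by (rule abs_l2_cases)
  obtain v where v: "v \<in> sq_integrable" "snd l = abs_l2 v" by (rule abs_l2_cases)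
  have yu: "(\<lambda>k. abs_l2 (y k)) \<longlonglongrightarrow> abs_l2 u" using tendsto_fst[OF pl] by (simp add: p u)
  have zv: "(\<lambda>k. abs_l2 (z k)) \<longlonglongrightarrow> abs_l2 v" using tendsto_snd[OF pl] by (simp add: p v)
  have "convergent (\<lambda>k. y k t)" for t
  proof -
    obtain C where C: "0 \<le> C"
      "\<And>y z s. maximal_pair J Q y z \<Longrightarrow> s \<in> {t..t} \<Longrightarrow> norm (y s) \<le> C * (norm (abs_l2 y) + norm (abs_l2 z))"
      using maximal_pair_bound_on_interval[OF AJ Q, of t t] by blast
    have le: "dist (y m t) (y n t) \<le> C * (dist (abs_l2 (y m)) (abs_l2 (y n)) + dist (abs_l2 (z m)) (abs_l2 (z n)))" for m n
      using C(2)[OF maximal_pair_diff[OF mp[of m] mp[of n]], of t]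
      by (simp add: dist_norm diff_abs_l2 y z)
    have "Cauchy (\<lambda>k. y k t)"
    proof (rule metric_CauchyI)
      fix e :: real assume e: "0 < e"
      define d where "d = e / (C + 1) / 2"
      have d: "0 < d" using e C(1) by (simp add: d_def)
      have dd: "d + d = e / (C + 1)" unfolding d_def by (rule field_sum_of_halves)
      obtain M1 where M1: "\<And>m n. m \<ge> M1 \<Longrightarrow> n \<ge> M1 \<Longrightarrow> dist (abs_l2 (y m)) (abs_l2 (y n)) < d"
        using metric_CauchyD[OF LIMSEQ_imp_Cauchy[OF yu] d] by blast
      obtain M2 where M2: "\<And>m n. m \<ge> M2 \<Longrightarrow> n \<ge> M2 \<Longrightarrow> dist (abs_l2 (z m)) (abs_l2 (z n)) < d"
        using metric_CauchyD[OF LIMSEQ_imp_Cauchy[OF zv] d] by blast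
      show "\<exists>M. \<forall>m\<ge>M. \<forall>n\<ge>M. dist (y m t) (y n t) < e"
      proof (intro exI[of _ "max M1 M2"] allI impI)
        fix m n assume mn: "max M1 M2 \<le> m" "max M1 M2 \<le> n"
        have "dist (y m t) (y n t) \<le> C * (d + d)"
          using M1[of m n] M2[of m n] mn C(1) by (intro order_trans[OF le] mult_left_mono add_mono) auto
        also have "\<dots> < (C + 1) * (d + d)" using d by simp
        also have "\<dots> = e" using C(1) by (simp add: dd)
        finally show "dist (y m t) (y n t) < e" .
      qed
    qed
    then show ?thesis by (simp add: Cauchy_convergent_iff)
  qed
  then obtain w where w: "\<And>t. (\<lambda>k. y k t) \<longlonglongrightarrow> w t" unfolding convergent_def by metis
  have bdd: "\<exists>M. \<forall>k. \<forall>t\<in>{a..b}. norm (y k t) \<le> M" for a b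
  proof -
    obtain C where C: "0 \<le> C"
      "\<And>y z s. maximal_pair J Q y z \<Longrightarrow> s \<in> {a..b} \<Longrightarrow> norm (y s) \<le> C * (norm (abs_l2 y) + norm (abs_l2 z))"
      using maximal_pair_bound_on_interval[OF AJ Q, of a b] by blast
    obtain M1 where M1: "\<And>k. norm (abs_l2 (y k)) \<le> M1"
      using convergent_imp_bounded[OF yu] by (auto simp: bounded_iff)
    obtain M2 where M2: "\<And>k. norm (abs_l2 (z k)) \<le> M2"
      using convergent_imp_bounded[OF zv] by (auto simp: bounded_iff)
    have "norm (y k t) \<le> C * (M1 + M2)" if "t \<in> {a..b}" for k t
      using order_trans[OF C(2)[OF mp that] mult_left_mono[OF add_mono[OF M1 M2] C(1)]] .
    then show ?thesis by blast
  qed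
  \<comment> \<open>Pointwise convergence and local uniform boundedness suffice to pass to the limit in the
    integrals of \<open>y\<^sub>k\<close> and \<open>Q y\<^sub>k\<close>.\<close>
  have wi: "w integrable_on {a..b} \<and> (\<lambda>k. integral {a..b} (y k)) \<longlonglongrightarrow> integral {a..b} w" for a b
  proof -
    obtain M where M: "\<And>k t. t \<in> {a..b} \<Longrightarrow> norm (y k t) \<le> M" using bdd[of a b] by blast
    have yi: "y k integrable_on {a..b}" for k
      using sq_integrable_absolutely_integrable_on[OF y(1)] by (simp add: absolutely_integrable_on_def)
    show ?thesis
      using dominated_convergence[where f=y and S="{a..b}" and g=w and h="\<lambda>x. M", OF yi integrable_const_ivl M w]
      by blast
  qed
  have Qw: "(\<lambda>x. Q x *v w x) absolutely_integrable_on {a..b} \<and>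
      (\<lambda>k. integral {a..b} (\<lambda>x. Q x *v y k x)) \<longlonglongrightarrow> integral {a..b} (\<lambda>x. Q x *v w x)" for a b
  proof -
    obtain M where M: "\<And>k t. t \<in> {a..b} \<Longrightarrow> norm (y k t) \<le> M" using bdd[of a b] by blast
    obtain B where B: "0 < B" "\<And>M :: complex ^ 'n ^ 'n. \<And>v. norm (M *v v) \<le> B * norm v * norm M"
      using bilinear_bounded_pos[OF bilinear_matrix_vector_mult] by blast
    have Qy: "(\<lambda>x. Q x *v y k x) absolutely_integrable_on {a..b}" for k
      by (rule absolutely_integrable_matrix_vector_mult[OF Q AC_loc_continuous[OF y(2)]])
    have Qyi: "(\<lambda>x. Q x *v y k x) integrable_on {a..b}" for k
      using Qy by (simp add: absolutely_integrable_on_def)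
    have h: "(\<lambda>x. B * M * norm (Q x)) integrable_on {a..b}"
      by (rule locally_integrable_norm_integrable[OF Q])
    have le: "norm (Q x *v y k x) \<le> B * M * norm (Q x)" if "x \<in> {a..b}" for k x
      using order_trans[OF B(2) mult_right_mono[OF mult_left_mono[OF M[OF that]]]] B(1) by simp
    have lim: "(\<lambda>k. Q x *v y k x) \<longlonglongrightarrow> Q x *v w x" for x
      by (rule bounded_linear.tendsto[OF matrix_vector_mul_bounded_linear w])
    have le': "norm (Q x *v w x) \<le> B * M * norm (Q x)" if "x \<in> {a..b}" for x
      by (rule Lim_bounded[OF tendsto_norm[OF lim]]) (use le[OF that] in blast)
    show ?thesis
    proof
      show "(\<lambda>x. Q x *v w x) absolutely_integrable_on {a..b}"
        by (rule dominated_convergence_absolutely_integrable[OF Qy h le' lim])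
      show "(\<lambda>k. integral {a..b} (\<lambda>x. Q x *v y k x)) \<longlonglongrightarrow> integral {a..b} (\<lambda>x. Q x *v w x)"
        by (rule dominated_convergence(2)[where f="\<lambda>k x. Q x *v y k x", OF Qyi h le lim])
    qed
  qed
  define g where "g x = A *v (v x - Q x *v w x)" for x
  have vi: "v absolutely_integrable_on {a..b}" for a b by (rule sq_integrable_absolutely_integrable_on[OF v(1)])
  have ga: "g absolutely_integrable_on {a..b}" for a b
    unfolding g_def[abs_def]
    using absolutely_integrable_linear[OF set_integral_diff(1)[OF vi conjunct1[OF Qw]] matrix_vector_mul_bounded_linear]
    by (simp add: o_def)
  have gi: "g integrable_on {a..b}" for a b using ga by (simp add: absolutely_integrable_on_def)
  have int_A: "integral {a..b} (\<lambda>x. A *v (f x - Q x *v h x)) = A *v (integral {a..b} f - integral {a..b} (\<lambda>x. Q x *v h x))"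
    if "f absolutely_integrable_on {a..b}" "(\<lambda>x. Q x *v h x) absolutely_integrable_on {a..b}" for a b f h
  proof -
    have i: "f integrable_on {a..b}" "(\<lambda>x. Q x *v h x) integrable_on {a..b}"
      using that by (auto simp: absolutely_integrable_on_def)
    show ?thesis
      using integral_linear[OF integrable_diff[OF i] matrix_vector_mul_bounded_linear, of A]
      by (simp add: o_def integral_diff[OF i])
  qed
  have wg: "w t - w s = integral {s..t} g" if st: "s \<le> t" for s t
  proof (rule LIMSEQ_unique)
    show "(\<lambda>k. y k t - y k s) \<longlonglongrightarrow> w t - w s" by (intro tendsto_intros w)
    have "y k t - y k s = A *v (integral {s..t} (z k) - integral {s..t} (\<lambda>x. Q x *v y k x))" for k
      using integral_unique[OF maximal_pair_integral_equation[OF AJ mp[of k] st]]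
        int_A[OF sq_integrable_absolutely_integrable_on[OF z]
          absolutely_integrable_matrix_vector_mult[OF Q AC_loc_continuous[OF y(2)]]]
      by simp
    moreover have "(\<lambda>k. A *v (integral {s..t} (z k) - integral {s..t} (\<lambda>x. Q x *v y k x)))
        \<longlonglongrightarrow> A *v (integral {s..t} v - integral {s..t} (\<lambda>x. Q x *v w x))"
      by (intro bounded_linear.tendsto[OF matrix_vector_mul_bounded_linear] tendsto_diff
          tendsto_integral_of_tendsto_abs_l2[OF z v(1) zv st] conjunct2[OF Qw])
    ultimately show "(\<lambda>k. y k t - y k s) \<longlonglongrightarrow> integral {s..t} g"
      unfolding g_def int_A[OF vi conjunct1[OF Qw]] by simp
  qed
  have wAC: "w \<in> AC_loc"
    unfolding AC_loc_def using abs_continuous_indefinite_integral[OF ga wg] by blast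
  have AE_neg: "AE x in lebesgue. P x" if "negligible N" "\<And>x. x \<notin> N \<Longrightarrow> P x" for N P
    using that by (auto simp: eventually_ae_filter negligible_iff_null_sets)
  obtain N where N: "negligible N" "\<And>x. x \<notin> N \<Longrightarrow> (w has_vector_derivative g x) (at x)"
    using has_vector_derivative_indefinite_integral[OF gi wg] by blast
  have "dirac_expr J Q w v"
    unfolding dirac_expr_def
  proof (rule AE_neg[OF N(1)])
    fix x assume "x \<notin> N"
    then show "\<exists>y'. (w has_vector_derivative y') (at x) \<and> v x = J *v y' + Q x *v w x"
      by (intro exI[of _ "g x"] conjI N(2)) (simp_all add: g_def matrix_vector_mul_assoc JA)
  qed
  have wu: "AE x in lebesgue. u x = w x"
  proof -
    have ui: "u integrable_on {a..b}" for a b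
      using sq_integrable_absolutely_integrable_on[OF u(1)] by (simp add: absolutely_integrable_on_def)
    have wui: "(\<lambda>x. w x - u x) integrable_on {a..b}" for a b
      using integrable_diff[OF conjunct1[OF wi] ui] .
    \<comment> \<open>The integral of \<open>w - u\<close> over every interval vanishes, so its indefinite integral is the zero
      function; differentiating gives \<open>w - u = 0\<close> almost everywhere.\<close>
    have "(0::complex ^ 'n) - 0 = integral {s..t} (\<lambda>x. w x - u x)" if st: "s \<le> t" for s t
    proof -
      have "integral {s..t} w = integral {s..t} u"
        using LIMSEQ_unique[OF conjunct2[OF wi] tendsto_integral_of_tendsto_abs_l2[OF y(1) u(1) yu st]] .
      then show ?thesis by (simp add: integral_diff conjunct1[OF wi] ui)
    qed
    then obtain N where N: "negligible N"
      "\<And>x. x \<notin> N \<Longrightarrow> ((\<lambda>x. 0::complex ^ 'n) has_vector_derivative w x - u x) (at x)"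
      using has_vector_derivative_indefinite_integral[of "\<lambda>x. w x - u x" "\<lambda>x. 0", OF wui] by blast
    show ?thesis
    proof (rule AE_neg[OF N(1)])
      fix x assume "x \<notin> N"
      from vector_derivative_unique_at[OF N(2)[OF this] has_vector_derivative_const] show "u x = w x" by simp
    qed
  qed
  have wm: "w \<in> borel_measurable lebesgue"
    using borel_measurable_AE[OF _ wu] u(1) by (simp add: sq_integrable_def)
  have "w \<in> sq_integrable"
  proof -
    have "integrable lebesgue (\<lambda>x. (norm (w x))\<^sup>2)"
    proof (subst integrable_cong_AE)
      show "(\<lambda>x. (norm (w x))\<^sup>2) \<in> borel_measurable lebesgue" using wm by measurable
      show "(\<lambda>x. (norm (u x))\<^sup>2) \<in> borel_measurable lebesgue"
        using u(1) by (auto simp: sq_integrable_def intro: borel_measurable_integrable)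
      show "AE x in lebesgue. (norm (w x))\<^sup>2 = (norm (u x))\<^sup>2" using wu by eventually_elim simp
      show "integrable lebesgue (\<lambda>x. (norm (u x))\<^sup>2)" using u(1) by (simp add: sq_integrable_def)
    qed
    then show ?thesis using wm by (simp add: sq_integrable_def)
  qed
  moreover from this have "abs_l2 u = abs_l2 w" using abs_l2_eq_iff[OF u(1)] wu by blast
  ultimately have "maximal_pair J Q w v" "l = (abs_l2 w, abs_l2 v)"
    using wAC \<open>dirac_expr J Q w v\<close> v u by (auto simp: maximal_pair_def prod_eq_iff)
  then show "l \<in> D_max J Q" by (auto simp: D_max_eq)
qed

theorem theorem1p1:
  fixes J :: "complex ^ 'n ^ 'n" and Q :: "real \<Rightarrow> complex ^ 'n ^ 'n"
  assumes "invertible J" and "J = - matrix_inv J" and "J = - conj_transpose J"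
    and "locally_integrable Q"
  shows "D_min J Q = D_max J Q"
proof
  show "D_min J Q \<subseteq> D_max J Q"
    unfolding D_min_def by (rule closure_minimal) (auto intro: closed_D_max[OF assms(1,4)])
  show "D_max J Q \<subseteq> D_min J Q" by (rule D_max_subset_D_min)
qed

end
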